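(* Let $K>0$, $\gamma>1$, let $g_{\alpha\beta}$ be a Lorentzian metric of signature $(-,+,+,+)$ in coordinates $(t,x^1,x^2,x^3)$ with $g^{00}<0$, let $\epsilon\geq0$ be a non-negative density function satisfying the causality condition $\gamma K\epsilon^{\gamma-1}<1$, and let $u^\alpha$ be a unit timelike vector ($g_{\alpha\beta}u^\alpha u^\beta=-1$) with $u^0>0$. Then the Euler system $$\nabla_\alpha T^{\alpha\beta}=0,\qquad T^{\alpha\beta}=(\epsilon+p)u^\alpha u^\beta+pg^{\alpha\beta},$$ coupled with the equation of state $p=K\epsilon^\gamma$, can be written as a symmetric hyperbolic system $$A^0(U)\partial_tU=A^a(U)\partial_aU+B(U),$$ for the unknown $U=(w,u^0,u^1,u^2,u^3)$, $w=\epsilon^{\frac{\gamma-1}{2}}$, where the matrices $A^\alpha(U)$ are symmetric and $A^0(U)$ is positive definite.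
   Context: Greek indices run over $0,\dots,3$, Latin over $1,2,3$, $x^0=t$; summation convention; $\nabla$ is the covariant derivative of $g$. The metric is regarded as given (coefficients depend on it and, in $B$, on its first derivatives through the Christoffel symbols). A first order quasi-linear $k\times k$ system $A^\alpha(U)\partial_\alpha U+B(U)=0$ is symmetric hyperbolic in a region $G$ if the matrices $A^\alpha(U)$ are symmetric and for every $U\in G$ there is a covector $\xi$ such that $\xi_\alpha A^\alpha(U)$ is positive definite. If $\xi=(1,0,0,0)$ is admissible, $A^0(U)$ is positive definite and the system can be put in the form displayed in the claim. "Can be written as" refers to the following. Set $P_{\alpha\beta}=g_{\alpha\beta}+u_\alpha u_\beta$ and $\Gamma_{\alpha\beta}=g_{\alpha\beta}+2u_\alpha u_\beta$. The Euler equations are decomposed into their components along $u^\alpha$ and orthogonal to it: $u^\nu\nabla_\nu\epsilon+(\epsilon+p)\nabla_\nu u^\nu=0$ and $(\epsilon+p)P_{\alpha\beta}u^\nu\nabla_\nu u^\beta+P^\nu{}_\alpha\nabla_\nu p=0$. The second is divided by $\epsilon+p$, and suitable multiples of the identity $u_\beta u^\nu\nabla_\nu u^\beta=0$ (a consequence of normalization) are added. With the Makino variable $w=\epsilon^{\frac{\gamma-1}{2}}$, $\sigma=\sqrt{dp/d\epsilon}=\sqrt{\gamma K}\,w$ and $\kappa=\frac{2}{\gamma-1}\frac{\sqrt{K\gamma}}{1+Kw^2}$, the resulting system is $$\kappa^2u^\nu\nabla_\nu w+\kappa\sigma P^\nu{}_\beta\nabla_\nu u^\beta=0,\qquad \kappa\sigma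 P^\nu{}_\alpha\nabla_\nu w+\Gamma_{\alpha\beta}u^\nu\nabla_\nu u^\beta=0,$$ in which the coefficients are $C^\infty$ functions of $w$, $u^\alpha$ and $g_{\alpha\beta}$, including at $w=0$.
   Formalization: The Euler system is shown equivalent to the symmetric hyperbolic system where ε>0; at vacuum points (ε=0) the Euler equations are void, so there only the implication from the symmetric hyperbolic system to the Euler system is stated. *)

theory Defs
  imports "HOL-Analysis.Analysis"
begin

section \<open>Smoothness and symmetric hyperbolicity\<close>

text \<open>\<open>Ck_on k S f\<close>: on the open set \<open>S\<close>, \<open>f\<close> has continuous iterated directional derivatives
  of all orders up to \<open>k\<close>; on finite-dimensional spaces this is the usual class $C^k$.\<close>

primrec Ck_on ::
  "nat \<Rightarrow> 'a::real_normed_vector set \<Rightarrow> ('a \<Rightarrow> 'b::real_normed_vector) \<Rightarrow> bool" where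
  "Ck_on 0 S f \<longleftrightarrow> continuous_on S f"
| "Ck_on (Suc k) S f \<longleftrightarrow>
     (\<forall>x\<in>S. f differentiable (at x)) \<and> (\<forall>v. Ck_on k S (\<lambda>x. frechet_derivative f (at x) v))"

definition Cinf_on ::
  "'a::real_normed_vector set \<Rightarrow> ('a \<Rightarrow> 'b::real_normed_vector) \<Rightarrow> bool" where
  "Cinf_on S f \<longleftrightarrow> (\<forall>k. Ck_on k S f)"

definition positive_definite :: "real^'k^'k \<Rightarrow> bool" where
  "positive_definite M \<longleftrightarrow> (\<forall>v. v \<noteq> 0 \<longrightarrow> v \<bullet> (M *v v) > 0)"

text \<open>Here \<open>A s \<alpha>\<close> is the coefficient of \<open>\<partial>\<^sub>\<alpha>U\<close> when all derivative terms stand on the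
  same side of the equation.\<close>

definition symmetric_hyperbolic_on :: "'s set \<Rightarrow> ('s \<Rightarrow> 4 \<Rightarrow> real^'k^'k) \<Rightarrow> bool" where
  "symmetric_hyperbolic_on G A \<longleftrightarrow>
     (\<forall>s\<in>G. (\<forall>\<alpha>. transpose (A s \<alpha>) = A s \<alpha>) \<and>
       (\<exists>\<xi>::real^4. positive_definite (\<Sum>\<alpha>\<in>UNIV. (\<xi> $ \<alpha>) *\<^sub>R A s \<alpha>)))"

section \<open>Lorentzian geometry in a coordinate chart\<close>

text \<open>Space-time indices are the elements \<open>0, 1, 2, 3\<close> of the type \<open>4\<close>; points are coordinate
  vectors \<open>x :: real^4\<close> with \<open>x $ 0 = t\<close>.  A metric at a point is its matrix
  $g_{\alpha\beta}$, and its inverse matrix is $g^{\alpha\beta}$.\<close>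

definition minkowski :: "real^4^4" where
  "minkowski = (\<chi> \<alpha> \<beta>. if \<alpha> = \<beta> then (if \<alpha> = 0 then -1 else 1) else 0)"

text \<open>Signature $(-,+,+,+)$: the form becomes the Minkowski form in a suitable basis.\<close>

definition lorentzian :: "real^4^4 \<Rightarrow> bool" where
  "lorentzian g \<longleftrightarrow> transpose g = g \<and>
     (\<exists>M. invertible M \<and> transpose M ** g ** M = minkowski)"

definition partial :: "4 \<Rightarrow> (real^4 \<Rightarrow> 'a::real_normed_vector) \<Rightarrow> real^4 \<Rightarrow> 'a" where
  "partial \<mu> f x = frechet_derivative f (at x) (axis \<mu> 1)"

text \<open>\<open>metric_deriv g x $ \<mu> $ \<alpha> $ \<beta>\<close> is $\partial_\mu g_{\alpha\beta}(x)$.\<close>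

definition metric_deriv :: "(real^4 \<Rightarrow> real^4^4) \<Rightarrow> real^4 \<Rightarrow> real^4^4^4" where
  "metric_deriv g x = (\<chi> \<mu>. partial \<mu> g x)"

text \<open>\<open>christoffel g x \<alpha> \<beta> \<gamma>\<close> is $\Gamma^\alpha{}_{\beta\gamma}(x)$ (not the tensor
  $\Gamma_{\alpha\beta}$ called \<open>Gam\<close> below).\<close>

definition christoffel :: "(real^4 \<Rightarrow> real^4^4) \<Rightarrow> real^4 \<Rightarrow> 4 \<Rightarrow> 4 \<Rightarrow> 4 \<Rightarrow> real" where
  "christoffel g x \<alpha> \<beta> \<gamma> = (1/2) * (\<Sum>\<mu>\<in>UNIV. matrix_inv (g x) $ \<alpha> $ \<mu> *
     (metric_deriv g x $ \<beta> $ \<mu> $ \<gamma> + metric_deriv g x $ \<gamma> $ \<mu> $ \<beta>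
      - metric_deriv g x $ \<mu> $ \<beta> $ \<gamma>))"

text \<open>\<open>cov_vec g u x \<nu> \<beta>\<close> is $\nabla_\nu u^\beta$, and \<open>cov_div g T x \<beta>\<close> is
  $\nabla_\alpha T^{\alpha\beta}$.\<close>

definition cov_vec :: "(real^4 \<Rightarrow> real^4^4) \<Rightarrow> (real^4 \<Rightarrow> real^4) \<Rightarrow> real^4 \<Rightarrow> 4 \<Rightarrow> 4 \<Rightarrow> real" where
  "cov_vec g u x \<nu> \<beta> =
     partial \<nu> (\<lambda>y. u y $ \<beta>) x + (\<Sum>\<mu>\<in>UNIV. christoffel g x \<beta> \<nu> \<mu> * u x $ \<mu>)"

definition cov_div :: "(real^4 \<Rightarrow> real^4^4) \<Rightarrow> (real^4 \<Rightarrow> real^4^4) \<Rightarrow> real^4 \<Rightarrow> 4 \<Rightarrow> real" where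
  "cov_div g T x \<beta> =
     (\<Sum>\<alpha>\<in>UNIV. partial \<alpha> (\<lambda>y. T y $ \<alpha> $ \<beta>) x
        + (\<Sum>\<mu>\<in>UNIV. christoffel g x \<alpha> \<alpha> \<mu> * T x $ \<mu> $ \<beta>)
        + (\<Sum>\<mu>\<in>UNIV. christoffel g x \<beta> \<alpha> \<mu> * T x $ \<alpha> $ \<mu>))"

section \<open>The Euler equations\<close>

definition pressure :: "real \<Rightarrow> real \<Rightarrow> real \<Rightarrow> real" where
  "pressure K \<gamma> \<epsilon> = K * \<epsilon> powr \<gamma>"

definition energy_momentum :: "real \<Rightarrow> real \<Rightarrow> (real^4 \<Rightarrow> real^4^4) \<Rightarrow> (real^4 \<Rightarrow> real) \<Rightarrow>
    (real^4 \<Rightarrow> real^4) \<Rightarrow> real^4 \<Rightarrow> real^4^4" where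
  "energy_momentum K \<gamma> g \<epsilon> u x =
     (\<chi> \<alpha> \<beta>. (\<epsilon> x + pressure K \<gamma> (\<epsilon> x)) * u x $ \<alpha> * u x $ \<beta>
        + pressure K \<gamma> (\<epsilon> x) * matrix_inv (g x) $ \<alpha> $ \<beta>)"

definition euler_eq :: "real \<Rightarrow> real \<Rightarrow> (real^4 \<Rightarrow> real^4^4) \<Rightarrow> (real^4 \<Rightarrow> real) \<Rightarrow>
    (real^4 \<Rightarrow> real^4) \<Rightarrow> real^4 \<Rightarrow> bool" where
  "euler_eq K \<gamma> g \<epsilon> u x \<longleftrightarrow> (\<forall>\<beta>. cov_div g (energy_momentum K \<gamma> g \<epsilon> u) x \<beta> = 0)"

text \<open>\<open>lower g v\<close> is $v_\alpha$, \<open>P_low\<close> is $P_{\alpha\beta}$, and \<open>P_mix g v \<nu> \<alpha>\<close> is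
  $P^\nu{}_\alpha = \delta^\nu_\alpha + v^\nu v_\alpha$.\<close>

definition lower :: "real^4^4 \<Rightarrow> real^4 \<Rightarrow> real^4" where
  "lower g v = g *v v"

definition P_low :: "real^4^4 \<Rightarrow> real^4 \<Rightarrow> 4 \<Rightarrow> 4 \<Rightarrow> real" where
  "P_low g v \<alpha> \<beta> = g $ \<alpha> $ \<beta> + lower g v $ \<alpha> * lower g v $ \<beta>"

definition P_mix :: "real^4^4 \<Rightarrow> real^4 \<Rightarrow> 4 \<Rightarrow> 4 \<Rightarrow> real" where
  "P_mix g v \<nu> \<alpha> = (if \<nu> = \<alpha> then 1 else 0) + v $ \<nu> * lower g v $ \<alpha>"

definition Gam :: "real^4^4 \<Rightarrow> real^4 \<Rightarrow> 4 \<Rightarrow> 4 \<Rightarrow> real" where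
  "Gam g v \<alpha> \<beta> = g $ \<alpha> $ \<beta> + 2 * lower g v $ \<alpha> * lower g v $ \<beta>"

text \<open>The components of the Euler equations along and orthogonal to the velocity.\<close>

definition decomposed_euler_eq :: "real \<Rightarrow> real \<Rightarrow> (real^4 \<Rightarrow> real^4^4) \<Rightarrow> (real^4 \<Rightarrow> real) \<Rightarrow>
    (real^4 \<Rightarrow> real^4) \<Rightarrow> real^4 \<Rightarrow> bool" where
  "decomposed_euler_eq K \<gamma> g \<epsilon> u x \<longleftrightarrow>
     (\<Sum>\<nu>\<in>UNIV. u x $ \<nu> * partial \<nu> \<epsilon> x)
       + (\<epsilon> x + pressure K \<gamma> (\<epsilon> x)) * (\<Sum>\<nu>\<in>UNIV. cov_vec g u x \<nu> \<nu>) = 0 \<and>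
     (\<forall>\<alpha>. (\<epsilon> x + pressure K \<gamma> (\<epsilon> x)) *
            (\<Sum>\<beta>\<in>UNIV. \<Sum>\<nu>\<in>UNIV. P_low (g x) (u x) \<alpha> \<beta> * u x $ \<nu> * cov_vec g u x \<nu> \<beta>)
          + (\<Sum>\<nu>\<in>UNIV. P_mix (g x) (u x) \<nu> \<alpha> * partial \<nu> (\<lambda>y. pressure K \<gamma> (\<epsilon> y)) x) = 0)"

section \<open>The system in the Makino variable\<close>

definition makino :: "real \<Rightarrow> real \<Rightarrow> real" where
  "makino \<gamma> \<epsilon> = \<epsilon> powr ((\<gamma> - 1) / 2)"

definition sound_speed :: "real \<Rightarrow> real \<Rightarrow> real \<Rightarrow> real" where
  "sound_speed K \<gamma> w = sqrt (\<gamma> * K) * w"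

lemma sound_speed_makino:
  assumes "K > 0" "\<gamma> > 1" "\<epsilon> > 0"
  shows "sound_speed K \<gamma> (makino \<gamma> \<epsilon>) = sqrt (deriv (pressure K \<gamma>) \<epsilon>)"
proof -
  have "(pressure K \<gamma> has_field_derivative K * (\<gamma> * \<epsilon> powr (\<gamma> - 1))) (at \<epsilon>)"
    unfolding pressure_def using assms by (auto intro!: derivative_eq_intros)
  then have *: "deriv (pressure K \<gamma>) \<epsilon> = (\<gamma> * K) * (makino \<gamma> \<epsilon>)\<^sup>2"
    using assms by (simp add: DERIV_imp_deriv makino_def power2_eq_square flip: powr_add)
  have "0 \<le> makino \<gamma> \<epsilon>" by (simp add: makino_def)
  then show ?thesis
    unfolding * by (simp add: sound_speed_def real_sqrt_mult)
qed

definition kappa :: "real \<Rightarrow> real \<Rightarrow> real \<Rightarrow> real" where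
  "kappa K \<gamma> w = 2 / (\<gamma> - 1) * (sqrt (K * \<gamma>) / (1 + K * w\<^sup>2))"

definition makino_eq :: "real \<Rightarrow> real \<Rightarrow> (real^4 \<Rightarrow> real^4^4) \<Rightarrow> (real^4 \<Rightarrow> real) \<Rightarrow>
    (real^4 \<Rightarrow> real^4) \<Rightarrow> real^4 \<Rightarrow> bool" where
  "makino_eq K \<gamma> g w u x \<longleftrightarrow>
     (kappa K \<gamma> (w x))\<^sup>2 * (\<Sum>\<nu>\<in>UNIV. u x $ \<nu> * partial \<nu> w x)
       + kappa K \<gamma> (w x) * sound_speed K \<gamma> (w x) *
         (\<Sum>\<nu>\<in>UNIV. \<Sum>\<beta>\<in>UNIV. P_mix (g x) (u x) \<nu> \<beta> * cov_vec g u x \<nu> \<beta>) = 0 \<and>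
     (\<forall>\<alpha>. kappa K \<gamma> (w x) * sound_speed K \<gamma> (w x) *
            (\<Sum>\<nu>\<in>UNIV. P_mix (g x) (u x) \<nu> \<alpha> * partial \<nu> w x)
          + (\<Sum>\<beta>\<in>UNIV. \<Sum>\<nu>\<in>UNIV. Gam (g x) (u x) \<alpha> \<beta> * u x $ \<nu> * cov_vec g u x \<nu> \<beta>) = 0)"

text \<open>The unknown $U = (w,u^0,u^1,u^2,u^3)$: the component with index \<open>None\<close> is $w$ and the one
  with index \<open>Some \<alpha>\<close> is $u^\alpha$.\<close>

definition unknown :: "real \<Rightarrow> real^4 \<Rightarrow> real^(4 option)" where
  "unknown w v = (\<chi> i. case i of None \<Rightarrow> w | Some \<alpha> \<Rightarrow> v $ \<alpha>)"

text \<open>The equation $A^0\partial_t U = A^a\partial_a U + B$ at \<open>x\<close>.  The metric is given, so \<open>A\<close> may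
  depend on its value at \<open>x\<close> and \<open>B\<close> on its value and first derivatives at \<open>x\<close>.\<close>

definition evolution_eq ::
  "((real^'k) \<times> (real^4^4) \<Rightarrow> 4 \<Rightarrow> real^'k^'k) \<Rightarrow>
   ((real^'k) \<times> (real^4^4) \<times> (real^4^4^4) \<Rightarrow> real^'k) \<Rightarrow>
   (real^4 \<Rightarrow> real^4^4) \<Rightarrow> (real^4 \<Rightarrow> real^'k) \<Rightarrow> real^4 \<Rightarrow> bool" where
  "evolution_eq A B g U x \<longleftrightarrow>
     A (U x, g x) 0 *v partial 0 U x =
       (\<Sum>a\<in>{1, 2, 3}. A (U x, g x) a *v partial a U x) + B (U x, g x, metric_deriv g x)"

section \<open>Admissible fluids\<close>

definition admissible :: "real \<Rightarrow> real \<Rightarrow> real^4^4 \<Rightarrow> real \<Rightarrow> real^4 \<Rightarrow> bool" where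
  "admissible K \<gamma> g \<epsilon> v \<longleftrightarrow>
     lorentzian g \<and> matrix_inv g $ 0 $ 0 < 0 \<and>
     \<epsilon> \<ge> 0 \<and> \<gamma> * K * \<epsilon> powr (\<gamma> - 1) < 1 \<and>
     (\<Sum>\<alpha>\<in>UNIV. \<Sum>\<beta>\<in>UNIV. g $ \<alpha> $ \<beta> * v $ \<alpha> * v $ \<beta>) = -1 \<and> v $ 0 > 0"

definition state_region :: "real \<Rightarrow> real \<Rightarrow> ((real^(4 option)) \<times> (real^4^4)) set" where
  "state_region K \<gamma> = {(unknown (makino \<gamma> \<epsilon>) v, g) | \<epsilon> v g. admissible K \<gamma> g \<epsilon> v}"

text \<open>Differentiability of the Makino variable does not follow from that of the density where the
  density vanishes (nor conversely), so both are required.\<close>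

definition fluid_on :: "real \<Rightarrow> real \<Rightarrow> (real^4) set \<Rightarrow> (real^4 \<Rightarrow> real^4^4) \<Rightarrow>
    (real^4 \<Rightarrow> real) \<Rightarrow> (real^4 \<Rightarrow> real^4) \<Rightarrow> bool" where
  "fluid_on K \<gamma> \<Omega> g \<epsilon> u \<longleftrightarrow> open \<Omega> \<and>
     (\<forall>x\<in>\<Omega>. admissible K \<gamma> (g x) (\<epsilon> x) (u x) \<and>
        g differentiable (at x) \<and> u differentiable (at x) \<and>
        \<epsilon> differentiable (at x) \<and> (\<lambda>y. makino \<gamma> (\<epsilon> y)) differentiable (at x))"

end

theory Submission
  imports Defs
begin

text \<open>The Euler system splits into its components along and orthogonal to the velocity.  Dividing by
  $\epsilon + p$, changing to the Makino variable and adding multiples of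
  $u_\beta u^\nu\nabla_\nu u^\beta = 0$ gives a system whose principal matrices are symmetric and smooth
  up to the vacuum; the Christoffel symbols only enter the source term.  Positivity of $A^0$ is
  a Cauchy--Schwarz estimate on the orthogonal complement of the velocity, on which \<open>g\<close> is positive
  definite: there the quadratic form of $A^0$ couples $w$ and $u^\alpha$ through the sound speed times
  the pairing with the gradient of \<open>t\<close>, and $g^{00} < 0$ together with the causality condition makes
  this coupling small.\<close>

section \<open>Smooth functions\<close>

text \<open>Symmetry dictates the scaling of the rows: \<open>kappa\<close> is the factor with kappa
  dw = \<sigma> d\<epsilon> / (\<epsilon> + p). Hence the pressure gradient divided by \<epsilon> +
  p is kappa \<sigma> dw, while the energy equation times kappa \<sigma> / (\<epsilon> + p) has the
  terms kappa^2 u(w) and kappa \<sigma> div u. Since the velocity is orthogonal to its own covariant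
  derivatives, div u can be written as a contraction with the projector, and then both mixed blocks
  coincide. The same orthogonality allows \<open>P_low\<close>, which annihilates the velocity and
  so is degenerate, to be replaced by \<open>Gam\<close>, which takes the value 1 on the velocity
  and agrees with g on its orthogonal complement. The factors relating the two systems are positive
  only for positive density. At a vacuum point the Euler equations are empty, whereas the evolution
  system still demands that w be stationary along the flow and that the acceleration vanish; so only
  one implication is claimed there.\<close>

text \<open>\<open>frechet_derivative\<close> is a choice among the derivatives for the full filter
  \<open>at x\<close>; on an open set both functions have the same derivatives at each point, so the
  same one is chosen.\<close>

lemma Ck_on_cong:
  assumes "open S" "\<And>x. x \<in> S \<Longrightarrow> f x = g x"
  shows "Ck_on k S f \<longleftrightarrow> Ck_on k S g"
  using assms(2)
proof (induction k arbitrary: f g)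
  case 0
  then show ?case using continuous_on_cong by auto
next
  case (Suc k)
  have d: "(f has_derivative D) (at x) \<longleftrightarrow> (g has_derivative D) (at x)" if "x \<in> S" for x D
    using has_derivative_transform_within_open[OF _ assms(1) that] Suc.prems by metis
  have "frechet_derivative f (at x) = frechet_derivative g (at x)" if "x \<in> S" for x
    unfolding frechet_derivative_def using d[OF that] by simp
  then have "Ck_on k S (\<lambda>x. frechet_derivative f (at x) v) \<longleftrightarrow>
      Ck_on k S (\<lambda>x. frechet_derivative g (at x) v)" for v
    by (intro Suc.IH) auto
  moreover have "f differentiable (at x) \<longleftrightarrow> g differentiable (at x)" if "x \<in> S" for x
    unfolding differentiable_def using d[OF that] by simp
  ultimately show ?case by simp
qed

text \<open>Replaces the choice in \<open>frechet_derivative\<close> by an explicit derivative, so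
  that the calculus rules below go by induction on the order.\<close>

lemma Ck_on_SucI:
  assumes "open S" "\<And>x. x \<in> S \<Longrightarrow> (f has_derivative D x) (at x)"
    "\<And>v. Ck_on k S (\<lambda>x. D x v)"
  shows "Ck_on (Suc k) S f"
proof -
  have "frechet_derivative f (at x) = D x" if "x \<in> S" for x
    using frechet_derivative_at[OF assms(2)[OF that]] by simp
  then have "Ck_on k S (\<lambda>x. frechet_derivative f (at x) v)" for v
    using Ck_on_cong[OF assms(1), of "\<lambda>x. frechet_derivative f (at x) v" "\<lambda>x. D x v"] assms(3)
    by auto
  then show ?thesis
    using assms(2) by (auto simp: differentiable_def)
qed

lemma Ck_on_SucD:
  assumes "Ck_on (Suc k) S f"
  shows "Ck_on k S f"
  using assms
proof (induction k arbitrary: f)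
  case 0
  then have "f differentiable (at x)" if "x \<in> S" for x using that by simp
  then show ?case
    by (auto intro!: continuous_at_imp_continuous_on differentiable_imp_continuous_within)
next
  case (Suc k)
  then show ?case by (metis Ck_on.simps(2))
qed

lemma Ck_on_Suc_has_derivative:
  "Ck_on (Suc k) S f \<Longrightarrow> x \<in> S \<Longrightarrow> (f has_derivative frechet_derivative f (at x)) (at x)"
  using frechet_derivative_works by auto

lemma Ck_on_const: "Ck_on k S (\<lambda>x. c)"
  by (induction k arbitrary: c) auto

lemma Ck_on_bounded_linear:
  assumes "open S" "bounded_linear f"
  shows "Ck_on k S f"
proof (cases k)
  case 0
  then show ?thesis using linear_continuous_on[OF assms(2)] by simp
next
  case (Suc n)
  then show ?thesis
    using Ck_on_SucI[OF assms(1), of f "\<lambda>x. f" n] bounded_linear_imp_has_derivative[OF assms(2)]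
    by (auto intro: Ck_on_const)
qed

lemma Ck_on_add:
  assumes "open S" "Ck_on k S f" "Ck_on k S g"
  shows "Ck_on k S (\<lambda>x. f x + g x)"
  using assms(2,3)
proof (induction k arbitrary: f g)
  case 0
  then show ?case by (auto intro: continuous_intros)
next
  case (Suc k)
  show ?case
    by (rule Ck_on_SucI[OF assms(1) has_derivative_add[OF Ck_on_Suc_has_derivative[OF Suc.prems(1)]
          Ck_on_Suc_has_derivative[OF Suc.prems(2)]]])
      (use Suc in auto)
qed

lemma Ck_on_uminus:
  assumes "open S" "Ck_on k S f"
  shows "Ck_on k S (\<lambda>x. - f x)"
  using assms(2)
proof (induction k arbitrary: f)
  case 0
  then show ?case by (auto intro: continuous_intros)
next
  case (Suc k)
  show ?case
    by (rule Ck_on_SucI[OF assms(1) has_derivative_minus[OF Ck_on_Suc_has_derivative[OF Suc.prems]]])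
      (use Suc in auto)
qed

text \<open>The product rule returns \<open>f\<close> and \<open>g\<close> themselves next to their
  derivatives, at one order less; hence the use of \<open>Ck_on_SucD\<close> and an induction over
  all pairs of functions.\<close>

lemma Ck_on_mult:
  fixes f g :: "'a::real_normed_vector \<Rightarrow> real"
  assumes "open S" "Ck_on k S f" "Ck_on k S g"
  shows "Ck_on k S (\<lambda>x. f x * g x)"
  using assms(2,3)
proof (induction k arbitrary: f g)
  case 0
  then show ?case by (auto intro: continuous_intros)
next
  case (Suc k)
  show ?case
  proof (rule Ck_on_SucI[OF assms(1) has_derivative_mult[OF Ck_on_Suc_has_derivative[OF Suc.prems(1)]
          Ck_on_Suc_has_derivative[OF Suc.prems(2)]]])
    show "Ck_on k S (\<lambda>x. f x * frechet_derivative g (at x) v + frechet_derivative f (at x) v * g x)"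
      for v
      using Suc.prems Ck_on_SucD by (intro Ck_on_add Suc.IH assms(1)) auto
  qed auto
qed

text \<open>The derivative of 1/f again contains 1/f, which the induction hypothesis covers at the
  lower order; \<open>f\<close> stays fixed throughout.\<close>

lemma Ck_on_inverse:
  fixes f :: "'a::real_normed_vector \<Rightarrow> real"
  assumes "open S" "Ck_on k S f" "\<And>x. x \<in> S \<Longrightarrow> f x \<noteq> 0"
  shows "Ck_on k S (\<lambda>x. inverse (f x))"
  using assms(2)
proof (induction k)
  case 0
  then show ?case using assms(3) by (auto intro!: continuous_intros)
next
  case (Suc k)
  have d: "((\<lambda>x. inverse (f x)) has_derivative
      (\<lambda>v. - 1 * (inverse (f x) * frechet_derivative f (at x) v * inverse (f x)))) (at x)"
    if "x \<in> S" for x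
    using Deriv.has_derivative_inverse[OF assms(3)[OF that] Ck_on_Suc_has_derivative[OF Suc.prems that]]
    by simp
  show ?case
    using Suc.prems Ck_on_SucD[OF Suc.prems]
    by (intro Ck_on_SucI[OF assms(1) d] Ck_on_mult Ck_on_const Suc.IH assms(1)) auto
qed

lemma Ck_on_vec_lambda:
  fixes f :: "'a::real_normed_vector \<Rightarrow> 'i::finite \<Rightarrow> 'b::euclidean_space"
  assumes "open S" "\<And>i. Ck_on k S (\<lambda>x. f x i)"
  shows "Ck_on k S (\<lambda>x. \<chi> i. f x i)"
  using assms(2)
proof (induction k arbitrary: f)
  case 0
  then show ?case by (auto intro: continuous_on_vec_lambda)
next
  case (Suc k)
  have "((\<lambda>x. \<chi> i. f x i) has_derivative
      (\<lambda>v. \<chi> i. frechet_derivative (\<lambda>x. f x i) (at x) v)) (at x)" if "x \<in> S" for x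
  proof -
    have "((\<lambda>x. f x i) has_derivative frechet_derivative (\<lambda>x. f x i) (at x)) (at x)" for i
      using Ck_on_Suc_has_derivative[OF Suc.prems that] .
    then show ?thesis
      by (subst has_derivative_componentwise_within)
         (auto simp: Basis_vec_def inner_axis intro!: has_derivative_inner_left)
  qed
  then show ?case
    by (rule Ck_on_SucI[OF assms(1)]) (use Suc in auto)
qed

named_theorems Cinf_intros

lemma Cinf_on_const [Cinf_intros]: "Cinf_on S (\<lambda>x. c)"
  by (simp add: Cinf_on_def Ck_on_const)

lemma Cinf_on_bounded_linear: "open S \<Longrightarrow> bounded_linear f \<Longrightarrow> Cinf_on S f"
  by (simp add: Cinf_on_def Ck_on_bounded_linear)

lemma Cinf_on_add [Cinf_intros]:
  "open S \<Longrightarrow> Cinf_on S f \<Longrightarrow> Cinf_on S g \<Longrightarrow> Cinf_on S (\<lambda>x. f x + g x)"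
  by (simp add: Cinf_on_def Ck_on_add)

lemma Cinf_on_mult [Cinf_intros]:
  fixes f g :: "'a::real_normed_vector \<Rightarrow> real"
  shows "open S \<Longrightarrow> Cinf_on S f \<Longrightarrow> Cinf_on S g \<Longrightarrow> Cinf_on S (\<lambda>x. f x * g x)"
  by (simp add: Cinf_on_def Ck_on_mult)

lemma Cinf_on_uminus [Cinf_intros]:
  "open S \<Longrightarrow> Cinf_on S f \<Longrightarrow> Cinf_on S (\<lambda>x. - f x)"
  by (simp add: Cinf_on_def Ck_on_uminus)

lemma Cinf_on_diff [Cinf_intros]:
  "open S \<Longrightarrow> Cinf_on S f \<Longrightarrow> Cinf_on S g \<Longrightarrow> Cinf_on S (\<lambda>x. f x - g x)"
  using Cinf_on_add[OF _ _ Cinf_on_uminus] by auto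

lemma Cinf_on_divide [Cinf_intros]:
  fixes f g :: "'a::real_normed_vector \<Rightarrow> real"
  assumes "open S" "Cinf_on S f" "Cinf_on S g" "\<And>x. x \<in> S \<Longrightarrow> g x \<noteq> 0"
  shows "Cinf_on S (\<lambda>x. f x / g x)"
  unfolding divide_inverse
  by (intro Cinf_on_mult) (use assms in \<open>auto simp: Cinf_on_def Ck_on_inverse\<close>)

lemma Cinf_on_power [Cinf_intros]:
  fixes f :: "'a::real_normed_vector \<Rightarrow> real"
  shows "open S \<Longrightarrow> Cinf_on S f \<Longrightarrow> Cinf_on S (\<lambda>x. f x ^ n)"
  by (induction n) (auto intro: Cinf_intros)

lemma Cinf_on_sum [Cinf_intros]:
  assumes "open S" "\<And>i. i \<in> I \<Longrightarrow> Cinf_on S (\<lambda>x. f x i)"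
  shows "Cinf_on S (\<lambda>x. \<Sum>i\<in>I. f x i)"
  using assms(2)
  by (induction I rule: infinite_finite_induct) (auto intro: Cinf_intros assms(1))

lemma Cinf_on_prod [Cinf_intros]:
  fixes f :: "'a::real_normed_vector \<Rightarrow> 'i \<Rightarrow> real"
  assumes "open S" "\<And>i. i \<in> I \<Longrightarrow> Cinf_on S (\<lambda>x. f x i)"
  shows "Cinf_on S (\<lambda>x. \<Prod>i\<in>I. f x i)"
  using assms(2)
  by (induction I rule: infinite_finite_induct) (auto intro: Cinf_intros assms(1))

lemma Cinf_on_vec_lambda [Cinf_intros]:
  fixes f :: "'a::real_normed_vector \<Rightarrow> 'i::finite \<Rightarrow> 'b::euclidean_space"
  shows "open S \<Longrightarrow> (\<And>i. Cinf_on S (\<lambda>x. f x i)) \<Longrightarrow> Cinf_on S (\<lambda>x. \<chi> i. f x i)"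
  by (simp add: Cinf_on_def Ck_on_vec_lambda)

lemma Cinf_on_cong:
  "open S \<Longrightarrow> (\<And>x. x \<in> S \<Longrightarrow> f x = g x) \<Longrightarrow> Cinf_on S f \<longleftrightarrow> Cinf_on S g"
  unfolding Cinf_on_def using Ck_on_cong by blast

lemma Cinf_on_differentiable: "Cinf_on S f \<Longrightarrow> x \<in> S \<Longrightarrow> f differentiable (at x)"
  unfolding Cinf_on_def by (metis Ck_on.simps(2))

lemma Cinf_on_continuous: "Cinf_on S f \<Longrightarrow> continuous_on S f"
  unfolding Cinf_on_def by (metis Ck_on.simps(1))

section \<open>Determinants and inverses of smooth matrix functions\<close>

lemma Cinf_on_det [Cinf_intros]:
  fixes f :: "'a::real_normed_vector \<Rightarrow> real^'n^'n"
  assumes "open S" "\<And>i j. Cinf_on S (\<lambda>x. f x $ i $ j)"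
  shows "Cinf_on S (\<lambda>x. det (f x))"
  unfolding det_def by (intro Cinf_intros assms)

lemma matrix_mul_matrix_inv:
  fixes A :: "real^'n^'n"
  assumes "invertible A"
  shows "A ** matrix_inv A = mat 1" "matrix_inv A ** A = mat 1"
  using someI_ex[OF assms[unfolded invertible_def]] unfolding matrix_inv_def by auto

text \<open>Column j of the inverse solves A x = e_j, so Cramer's rule gives its entry i.\<close>

lemma matrix_inv_cramer:
  fixes A :: "real^'n^'n"
  assumes "invertible A"
  shows "matrix_inv A $ i $ j =
    det (\<chi> k l. if l = i then (if k = j then 1 else 0) else A $ k $ l) / det A"
proof -
  have d: "det A \<noteq> 0" using assms invertible_det_nz by blast
  have "A *v (matrix_inv A *v axis j 1) = axis j 1"
    using matrix_mul_matrix_inv(1)[OF assms] by (simp add: matrix_vector_mul_assoc)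
  then have "matrix_inv A *v axis j 1 =
      (\<chi> k. det (\<chi> i l. if l = k then axis j 1 $ i else A $ i $ l) / det A)"
    using cramer[OF d] by blast
  then have "(matrix_inv A *v axis j 1) $ i =
     det (\<chi> k l. if l = i then axis j 1 $ k else A $ k $ l) / det A" by simp
  then show ?thesis
    by (simp add: matrix_vector_mult_basis column_def)
      (simp add: axis_def cong: if_cong)
qed

text \<open>Cramer's rule makes each entry a quotient of determinants. This serves both the
  smoothness of the source term and the differentiability of the inverse metric along the
  chart.\<close>

lemma Cinf_on_matrix_inv [Cinf_intros]:
  fixes f :: "'a::real_normed_vector \<Rightarrow> real^'n^'n"
  assumes S: "open S" and f: "\<And>i j. Cinf_on S (\<lambda>x. f x $ i $ j)"
    and inv: "\<And>x. x \<in> S \<Longrightarrow> invertible (f x)"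
  shows "Cinf_on S (\<lambda>x. matrix_inv (f x) $ i $ j)"
proof -
  have "Cinf_on S (\<lambda>x. det (\<chi> k l. if l = i then (if k = j then 1 else 0) else f x $ k $ l) / det (f x))"
  proof (intro Cinf_intros S f)
    show "Cinf_on S (\<lambda>x. (\<chi> k l. if l = i then (if k = j then 1 else 0) else f x $ k $ l) $ a $ b)"
      for a b by (cases "b = i") (simp_all add: Cinf_on_const f)
  qed (use inv invertible_det_nz in blast)
  then show ?thesis
    by (subst Cinf_on_cong[OF S matrix_inv_cramer[OF inv]]) auto
qed

lemma open_invertible: "open {A :: real^'n^'n. invertible A}"
proof -
  have "continuous_on UNIV (det :: real^'n^'n \<Rightarrow> real)"
    by (intro Cinf_on_continuous Cinf_on_det Cinf_on_bounded_linear bounded_linear_compose[OF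
      bounded_linear_vec_nth bounded_linear_vec_nth]) auto
  then show ?thesis
    unfolding invertible_det_nz by (intro open_Collect_neq) auto
qed

section \<open>Positivity of the principal part\<close>

text \<open>The enumeration \<open>UNIV_4\<close> uses 1, 2, 3, 4; in the type \<open>4\<close> the
  last of these equals 0, the time index.\<close>

lemma UNIV_4_zero: "(UNIV :: 4 set) = {0, 1, 2, 3}"
  using UNIV_4 by auto

lemma sum_4_zero: "(\<Sum>\<alpha>\<in>(UNIV :: 4 set). f \<alpha>) = f 0 + (f 1 + (f 2 + f 3 :: 'a::comm_monoid_add))"
proof -
  have "(4 :: 4) = 0" by simp
  then show ?thesis unfolding sum_4 by (simp only: ac_simps)
qed

lemma sum_option: "(\<Sum>i\<in>UNIV. f i) = (f None + (\<Sum>\<alpha>\<in>(UNIV :: 'b::finite set). f (Some \<alpha>)) :: 'a::comm_monoid_add)"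
  by (simp add: UNIV_option_conv sum.reindex)

section \<open>Quadratic forms of Lorentzian metrics\<close>

lemma inner_matrix_vector_mult:
  fixes x y :: "real^'n" and A :: "real^'m^'n"
  shows "x \<bullet> (A *v z) = (\<Sum>i\<in>UNIV. \<Sum>j\<in>UNIV. A $ i $ j * x $ i * z $ j)"
  by (simp add: inner_vec_def matrix_vector_mult_def sum_distrib_left mult_ac)

lemma inner_matrix_commute:
  fixes x y :: "real^'n" and A :: "real^'n^'n"
  assumes "transpose A = A"
  shows "x \<bullet> (A *v y) = y \<bullet> (A *v x)"
  by (metis assms dot_lmul_matrix inner_commute transpose_matrix_vector)

text \<open>Orthogonality ties the time component of z to the spatial product c, and u0^2 = 1 + a
  exceeds the spatial square a of u; the spatial Cauchy-Schwarz inequality then keeps z0^2 below the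
  spatial square b of z.\<close>

lemma minkowski_orthogonal_pos:
  assumes u: "u \<bullet> (minkowski *v u) = -1" and uz: "u \<bullet> (minkowski *v z) = 0" and z: "z \<noteq> 0"
  shows "z \<bullet> (minkowski *v z) > 0"
proof -
  define a b c where "a = (u$1)\<^sup>2 + (u$2)\<^sup>2 + (u$3)\<^sup>2" and "b = (z$1)\<^sup>2 + (z$2)\<^sup>2 + (z$3)\<^sup>2"
    and "c = u$1 * z$1 + u$2 * z$2 + u$3 * z$3"
  note sums = inner_matrix_vector_mult sum_4_zero minkowski_def
  have u0: "(u$0)\<^sup>2 = 1 + a" using u by (simp add: sums a_def power2_eq_square)
  have c: "u$0 * z$0 = c" using uz by (simp add: sums c_def)
  \<comment> \<open>Lagrange's identity.\<close>
  have "a * b - c\<^sup>2 = (u$1 * z$2 - u$2 * z$1)\<^sup>2 + (u$1 * z$3 - u$3 * z$1)\<^sup>2 + (u$2 * z$3 - u$3 * z$2)\<^sup>2"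
    unfolding a_def b_def c_def by algebra
  then have cs: "c\<^sup>2 \<le> a * b" by (smt (verit) zero_le_power2)
  have a: "a \<ge> 0" and b: "b \<ge> 0" by (auto simp: a_def b_def)
  have "b \<noteq> 0"
  proof
    assume "b = 0"
    then have z3: "z$1 = 0" "z$2 = 0" "z$3 = 0"
      by (auto simp: b_def add_nonneg_eq_0_iff)
    then have "u$0 * z$0 = 0" using c by (simp add: c_def)
    then have "z$0 = 0" using u0 a by auto
    then have "z = 0" using z3 UNIV_4_zero
      by (auto simp: vec_eq_iff) (metis UNIV_I insertE singletonD)
    then show False using z by simp
  qed
  \<comment> \<open>Here (1 + a) z0^2 = (u0 z0)^2 = c^2.\<close>
  have "(1 + a) * (b - (z$0)\<^sup>2) = b + (a * b - c\<^sup>2)"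
    using c u0 by (simp add: algebra_simps flip: c)
  then have "(1 + a) * (b - (z$0)\<^sup>2) > 0" using \<open>b \<noteq> 0\<close> b cs by linarith
  then have "b > (z$0)\<^sup>2" using a by (auto simp: zero_less_mult_iff)
  then show ?thesis by (simp add: sums b_def power2_eq_square)
qed

lemma lorentzian_transpose: "lorentzian g \<Longrightarrow> transpose g = g"
  by (simp add: lorentzian_def)

lemma lorentzian_sym: "lorentzian g \<Longrightarrow> g $ \<alpha> $ \<beta> = g $ \<beta> $ \<alpha>"
  using arg_cong[OF lorentzian_transpose, of g "\<lambda>m. m $ \<beta> $ \<alpha>"] by (simp add: transpose_def)

lemma lorentzian_invertible:
  assumes "lorentzian g"
  shows "invertible g"
proof -
  obtain M where M: "transpose M ** g ** M = minkowski"
    using assms by (auto simp: lorentzian_def)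
  have "det minkowski = (\<Prod>i\<in>UNIV. minkowski $ i $ i)"
    by (rule det_diagonal) (simp add: minkowski_def)
  then have "det minkowski \<noteq> 0" by (simp add: minkowski_def)
  then have "det g \<noteq> 0" unfolding M[symmetric] by (simp add: det_mul)
  then show ?thesis by (simp add: invertible_det_nz)
qed

text \<open>In the coordinates N x, with N inverse to the basis matrix M, the form g becomes the
  Minkowski form.\<close>

lemma lorentzian_orthogonal_pos:
  assumes g: "lorentzian g" and u: "u \<bullet> (g *v u) = -1" and uz: "u \<bullet> (g *v z) = 0" and z: "z \<noteq> 0"
  shows "z \<bullet> (g *v z) > 0"
proof -
  obtain M where M: "invertible M" "transpose M ** g ** M = minkowski"
    using g by (auto simp: lorentzian_def)
  obtain N where N: "M ** N = mat 1" using M(1) by (auto simp: invertible_def)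
  have form: "x \<bullet> (g *v y) = (N *v x) \<bullet> (minkowski *v (N *v y))" for x y
  proof -
    have "M *v (N *v v) = v" for v by (simp add: matrix_vector_mul_assoc N)
    then show ?thesis
      unfolding M(2)[symmetric]
      by (metis dot_lmul_matrix inner_commute matrix_vector_mul_assoc transpose_matrix_vector transpose_transpose)
  qed
  have "N *v z \<noteq> 0"
    using z N by (metis matrix_vector_mul_assoc matrix_vector_mul_lid matrix_vector_mult_0_right)
  then show ?thesis
    using minkowski_orthogonal_pos[of "N *v u" "N *v z"] u uz by (simp add: form)
qed

text \<open>As g is indefinite, the usual argument is run inside the orthogonal complement of u: the
  combination q z - b y stays there, where the form is nonnegative.\<close>

lemma lorentzian_orthogonal_Cauchy_Schwarz:
  assumes g: "lorentzian g" and u: "u \<bullet> (g *v u) = -1"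
    and y: "u \<bullet> (g *v y) = 0" and z: "u \<bullet> (g *v z) = 0"
  shows "(z \<bullet> (g *v y))\<^sup>2 \<le> (z \<bullet> (g *v z)) * (y \<bullet> (g *v y))"
proof (cases "y = 0")
  case False
  define q where "q = y \<bullet> (g *v y)"
  have q: "q > 0" using lorentzian_orthogonal_pos[OF g u y False] by (simp add: q_def)
  define b where "b = z \<bullet> (g *v y)"
  define x where "x = q *\<^sub>R z - b *\<^sub>R y"
  have lin: "g *v x = q *\<^sub>R (g *v z) - b *\<^sub>R (g *v y)"
    by (simp add: x_def matrix_vector_mult_diff_distrib matrix_vector_mult_scaleR)
  have "u \<bullet> (g *v x) = 0" using y z by (simp add: lin inner_diff_right)
  then have "x \<bullet> (g *v x) \<ge> 0"
    using lorentzian_orthogonal_pos[OF g u, of x] by (cases "x = 0") auto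
  moreover have "y \<bullet> (g *v z) = b"
    using inner_matrix_commute[OF lorentzian_transpose[OF g]] by (simp add: b_def)
  then have "x \<bullet> (g *v x) = q * (q * (z \<bullet> (g *v z)) - b\<^sup>2)"
    unfolding lin unfolding x_def
    by (simp add: inner_diff_left inner_diff_right algebra_simps power2_eq_square flip: q_def b_def)
  ultimately have "q * (z \<bullet> (g *v z)) - b\<^sup>2 \<ge> 0" using q by (simp add: zero_le_mult_iff)
  then show ?thesis by (simp add: q_def b_def mult.commute)
qed simp

text \<open>With \<open>z\<close> the component of \<open>x\<close> orthogonal to the velocity, $z^0$ is the pairing of \<open>z\<close> with the
  projection of the gradient of \<open>t\<close>, whose square is $(u^0)^2 + g^{00}$; since this is less than
  $(u^0)^2$, the mixed term is dominated as soon as the sound speed is at most 1.\<close>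

lemma principal_form_pos:
  assumes g: "lorentzian g" and g00: "matrix_inv g $ 0 $ 0 < 0"
    and u: "u \<bullet> (g *v u) = -1" and u0: "u $ 0 > 0" and \<sigma>: "\<bar>\<sigma>\<bar> \<le> 1" and xy: "x \<noteq> 0 \<or> y \<noteq> 0"
  shows "u $ 0 * y\<^sup>2 + 2 * \<sigma> * y * (x $ 0 + u $ 0 * (u \<bullet> (g *v x)))
    + u $ 0 * (x \<bullet> (g *v x) + 2 * (u \<bullet> (g *v x))\<^sup>2) > 0" (is "?F > 0")
proof -
  define c where "c = u \<bullet> (g *v x)"
  define z where "z = x + c *\<^sub>R u"
  \<comment> \<open>\<open>e\<close> is the gradient of t and \<open>n\<close> its projection
    orthogonal to u.\<close>
  define e where "e = matrix_inv g *v axis 0 1"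
  define n where "n = e + (u $ 0) *\<^sub>R u"
  note com = inner_matrix_commute[OF lorentzian_transpose[OF g]]
  have ge: "g *v e = axis 0 1"
    using matrix_mul_matrix_inv[OF lorentzian_invertible[OF g]]
    by (simp add: e_def matrix_vector_mul_assoc)
  have gn: "v \<bullet> (g *v n) = v $ 0 + u $ 0 * (v \<bullet> (g *v u))" for v
    by (simp add: n_def matrix_vector_right_distrib matrix_vector_mult_scaleR inner_add_right ge inner_axis)
  have gz: "v \<bullet> (g *v z) = v \<bullet> (g *v x) + c * (v \<bullet> (g *v u))" for v
    by (simp add: z_def matrix_vector_right_distrib matrix_vector_mult_scaleR inner_add_right)
  have uz: "u \<bullet> (g *v z) = 0" unfolding gz u by (simp add: c_def)
  have un: "u \<bullet> (g *v n) = 0" using u by (simp add: gn)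
  have zn: "z \<bullet> (g *v n) = z $ 0" unfolding gn com[of z u] uz by simp
  have "e $ 0 = matrix_inv g $ 0 $ 0" by (simp add: e_def matrix_vector_mult_basis column_def)
  moreover have "n \<bullet> (g *v n) = n $ 0" using gn[of n] com[of n u] un by simp
  ultimately have nn: "n \<bullet> (g *v n) = matrix_inv g $ 0 $ 0 + (u $ 0)\<^sup>2"
    by (simp add: n_def power2_eq_square)
  define q where "q = z \<bullet> (g *v z)"
  have q: "q = x \<bullet> (g *v x) + c\<^sup>2"
  proof -
    have "q = x \<bullet> (g *v z) + c * (u \<bullet> (g *v z))" unfolding q_def z_def by (simp add: inner_add_left)
    also have "\<dots> = x \<bullet> (g *v x) + c\<^sup>2"
      unfolding uz by (simp add: gz com[of x u] power2_eq_square flip: c_def)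
    finally show ?thesis .
  qed
  have q0: "q > 0" if "z \<noteq> 0" using lorentzian_orthogonal_pos[OF g u uz that] by (simp add: q_def)
  have cs: "(z $ 0)\<^sup>2 < (u $ 0)\<^sup>2 * q" if "z \<noteq> 0"
  proof -
    have "(z $ 0)\<^sup>2 \<le> q * (matrix_inv g $ 0 $ 0 + (u $ 0)\<^sup>2)"
      using lorentzian_orthogonal_Cauchy_Schwarz[OF g u un uz] by (simp add: zn nn q_def)
    also have "\<dots> < q * (u $ 0)\<^sup>2" using q0[OF that] g00 by simp
    finally show ?thesis by (simp add: mult.commute)
  qed
  have F: "?F = u $ 0 * y\<^sup>2 + 2 * \<sigma> * y * z $ 0 + u $ 0 * (q + c\<^sup>2)"
    by (simp add: z_def q mult.commute[of c] flip: c_def)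
  \<comment> \<open>Multiplying by u0 > 0 completes the square in y without fractions; the middle
    bracket is controlled by \<open>cs\<close>.\<close>
  have F2: "u $ 0 * ?F = (u $ 0 * y + \<sigma> * z $ 0)\<^sup>2 + ((u $ 0)\<^sup>2 * q - \<sigma>\<^sup>2 * (z $ 0)\<^sup>2) + (u $ 0 * c)\<^sup>2"
    unfolding F by algebra
  have "u $ 0 * ?F > 0"
  proof (cases "z = 0")
    case True
    \<comment> \<open>Here x is parallel to u. The mixed term disappears with z, and the c^2 left
      over from -c^2 in g and 2 c^2 in the added term supplies positivity.\<close>
    then have x: "x = - c *\<^sub>R u" by (simp add: z_def eq_neg_iff_add_eq_0)
    then have "y \<noteq> 0 \<or> c \<noteq> 0" using xy by auto
    then have "(u $ 0 * y)\<^sup>2 + (u $ 0 * c)\<^sup>2 > 0" using u0 by (simp add: sum_power2_gt_zero_iff)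
    then show ?thesis unfolding F2 using True by (simp add: q_def)
  next
    case False
    have "\<sigma>\<^sup>2 * (z $ 0)\<^sup>2 \<le> 1 * (z $ 0)\<^sup>2"
      using \<sigma> by (intro mult_right_mono) (auto simp: abs_square_le_1)
    then have "(u $ 0)\<^sup>2 * q - \<sigma>\<^sup>2 * (z $ 0)\<^sup>2 > 0" using cs[OF False] by simp
    then show ?thesis unfolding F2 by (smt (verit) zero_le_power2)
  qed
  then show ?thesis using u0 by (simp add: zero_less_mult_iff)
qed

section \<open>The principal matrices and their quadratic form\<close>

definition velocity :: "real^(4 option) \<Rightarrow> real^4" where
  "velocity U = (\<chi> \<alpha>. U $ Some \<alpha>)"

lemma velocity_unknown [simp]: "velocity (unknown w v) = v"
  by (simp add: velocity_def unknown_def vec_eq_iff)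

lemma unknown_None [simp]: "unknown w v $ None = w"
  by (simp add: unknown_def)

lemma unknown_Some [simp]: "unknown w v $ Some \<alpha> = v $ \<alpha>"
  by (simp add: unknown_def)

lemma unknown_cases: obtains w v where "U = unknown w v"
proof
  show "U = unknown (U $ None) (velocity U)"
    by (simp add: vec_eq_iff unknown_def velocity_def split: option.split)
qed

text \<open>Keeping the free index of the momentum rows lowered makes the \<open>Gam\<close> block
  symmetric and keeps the inverse metric out of the matrix.\<close>

definition principal_matrix :: "real \<Rightarrow> real \<Rightarrow> (real^(4 option)) \<times> (real^4^4) \<Rightarrow> 4 \<Rightarrow> real^(4 option)^(4 option)"
  where "principal_matrix K \<gamma> s \<nu> = (let U = fst s; g = snd s; w = U $ None; v = velocity U in
    \<chi> i j. case i of
      None \<Rightarrow> (case j of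
        None \<Rightarrow> (kappa K \<gamma> w)\<^sup>2 * v $ \<nu>
      | Some \<beta> \<Rightarrow> kappa K \<gamma> w * sound_speed K \<gamma> w * P_mix g v \<nu> \<beta>)
    | Some \<alpha> \<Rightarrow> (case j of
        None \<Rightarrow> kappa K \<gamma> w * sound_speed K \<gamma> w * P_mix g v \<nu> \<alpha>
      | Some \<beta> \<Rightarrow> Gam g v \<alpha> \<beta> * v $ \<nu>))"

lemma principal_matrix_nth [simp]:
  "principal_matrix K \<gamma> (unknown w v, g) \<nu> $ None $ None = (kappa K \<gamma> w)\<^sup>2 * v $ \<nu>"
  "principal_matrix K \<gamma> (unknown w v, g) \<nu> $ None $ Some \<beta> = kappa K \<gamma> w * sound_speed K \<gamma> w * P_mix g v \<nu> \<beta>"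
  "principal_matrix K \<gamma> (unknown w v, g) \<nu> $ Some \<alpha> $ None = kappa K \<gamma> w * sound_speed K \<gamma> w * P_mix g v \<nu> \<alpha>"
  "principal_matrix K \<gamma> (unknown w v, g) \<nu> $ Some \<alpha> $ Some \<beta> = Gam g v \<alpha> \<beta> * v $ \<nu>"
  by (simp_all add: principal_matrix_def)

lemma transpose_principal:
  assumes "lorentzian (snd s)"
  shows "transpose (principal_matrix K \<gamma> s \<nu>) = principal_matrix K \<gamma> s \<nu>"
  using lorentzian_sym[OF assms]
  by (auto simp: principal_matrix_def Let_def transpose_def vec_eq_iff Gam_def split: option.splits)

lemma kappa_pos: "K > 0 \<Longrightarrow> \<gamma> > 1 \<Longrightarrow> kappa K \<gamma> w > 0"
  unfolding kappa_def by (intro mult_pos_pos divide_pos_pos) (auto intro!: add_pos_nonneg)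

text \<open>The substitution y = kappa a absorbs every factor kappa; for \<nu> = 0 this is the form
  of \<open>principal_form_pos\<close> with the sound speed as \<sigma>.\<close>

lemma inner_principal:
  "unknown a x \<bullet> (principal_matrix K \<gamma> (unknown w v, g) \<nu> *v unknown a x) =
    v $ \<nu> * (kappa K \<gamma> w * a)\<^sup>2
    + 2 * sound_speed K \<gamma> w * (kappa K \<gamma> w * a) * (x $ \<nu> + v $ \<nu> * (x \<bullet> (g *v v)))
    + v $ \<nu> * (x \<bullet> (g *v x) + 2 * (x \<bullet> (g *v v))\<^sup>2)"
proof -
  have P: "(\<Sum>\<beta>\<in>UNIV. P_mix g v \<nu> \<beta> * x $ \<beta>) = x $ \<nu> + v $ \<nu> * (x \<bullet> (g *v v))"
    by (simp add: P_mix_def lower_def distrib_right sum.distrib if_distribR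
        inner_vec_def sum_distrib_left mult.assoc mult.left_commute
        if_distrib[of "\<lambda>t. t * _"] cong: if_cong)
      (simp add: mult.commute)
  have "(\<Sum>\<alpha>\<in>UNIV. \<Sum>\<beta>\<in>UNIV. Gam g v \<alpha> \<beta> * x $ \<alpha> * x $ \<beta>) =
     x \<bullet> (g *v x) + (\<Sum>\<alpha>\<in>UNIV. \<Sum>\<beta>\<in>UNIV. 2 * (x $ \<alpha> * lower g v $ \<alpha>) * (x $ \<beta> * lower g v $ \<beta>))"
    unfolding inner_matrix_vector_mult Gam_def by (simp add: algebra_simps sum.distrib)
  also have "(\<Sum>\<alpha>\<in>UNIV. \<Sum>\<beta>\<in>UNIV. 2 * (x $ \<alpha> * lower g v $ \<alpha>) * (x $ \<beta> * lower g v $ \<beta>)) =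
      2 * (x \<bullet> (g *v v))\<^sup>2"
    by (simp add: power2_eq_square inner_vec_def lower_def sum_product sum_distrib_left mult_ac)
  finally have G: "(\<Sum>\<alpha>\<in>UNIV. \<Sum>\<beta>\<in>UNIV. Gam g v \<alpha> \<beta> * x $ \<alpha> * x $ \<beta>) =
     x \<bullet> (g *v x) + 2 * (x \<bullet> (g *v v))\<^sup>2" .
  have "unknown a x \<bullet> (principal_matrix K \<gamma> (unknown w v, g) \<nu> *v unknown a x) =
    v $ \<nu> * (kappa K \<gamma> w * a)\<^sup>2
    + 2 * sound_speed K \<gamma> w * (kappa K \<gamma> w * a) * (\<Sum>\<beta>\<in>UNIV. P_mix g v \<nu> \<beta> * x $ \<beta>)
    + v $ \<nu> * (\<Sum>\<alpha>\<in>UNIV. \<Sum>\<beta>\<in>UNIV. Gam g v \<alpha> \<beta> * x $ \<alpha> * x $ \<beta>)"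
    unfolding inner_matrix_vector_mult
    by (simp add: sum_option sum.distrib sum_distrib_left power2_eq_square mult_ac)
  then show ?thesis unfolding P G .
qed

lemma positive_definite_principal:
  assumes K: "K > 0" "\<gamma> > 1" and adm: "admissible K \<gamma> g \<epsilon> v"
  shows "positive_definite (principal_matrix K \<gamma> (unknown (makino \<gamma> \<epsilon>) v, g) 0)"
proof -
  let ?w = "makino \<gamma> \<epsilon>"
  have g: "lorentzian g" and rest: "matrix_inv g $ 0 $ 0 < 0" "v \<bullet> (g *v v) = -1" "v $ 0 > 0"
    using adm by (auto simp: admissible_def inner_matrix_vector_mult)
  \<comment> \<open>The causality condition is a bound on the squared sound speed.\<close>
  have "(sound_speed K \<gamma> ?w)\<^sup>2 = \<gamma> * K * \<epsilon> powr (\<gamma> - 1)"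
    using K by (simp add: sound_speed_def makino_def power_mult_distrib power2_eq_square[of "_ powr _"] flip: powr_add)
  also have "\<dots> \<le> 1" using adm by (simp add: admissible_def)
  finally have \<sigma>: "\<bar>sound_speed K \<gamma> ?w\<bar> \<le> 1" by (simp add: abs_square_le_1)
  have "U \<bullet> (principal_matrix K \<gamma> (unknown ?w v, g) 0 *v U) > 0" if "U \<noteq> 0" for U
  proof -
    obtain a x where U: "U = unknown a x" by (rule unknown_cases)
    have "x \<noteq> 0 \<or> kappa K \<gamma> ?w * a \<noteq> 0"
      using that kappa_pos[OF K, of ?w] U by (auto simp: vec_eq_iff unknown_def split: option.split_asm)
    from principal_form_pos[OF g rest \<sigma> this] show ?thesis
      unfolding U inner_principal inner_matrix_commute[OF lorentzian_transpose[OF g], of x v] .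
  qed
  then show ?thesis by (simp add: positive_definite_def)
qed

section \<open>Partial derivatives\<close>

lemma partial_has_derivative: "(f has_derivative D) (at x) \<Longrightarrow> partial \<nu> f x = D (axis \<nu> 1)"
  unfolding partial_def using frechet_derivative_at by metis

lemma partial_const [simp]: "partial \<nu> (\<lambda>y. c) x = 0"
  by (rule partial_has_derivative[OF has_derivative_const])

lemma partial_add:
  assumes "f differentiable (at x)" "h differentiable (at x)"
  shows "partial \<nu> (\<lambda>y. f y + h y) x = partial \<nu> f x + partial \<nu> h x"
  using assms unfolding frechet_derivative_works
  by (subst partial_has_derivative[OF has_derivative_add]) (auto simp: partial_def)

lemma partial_mult:
  fixes f h :: "real^4 \<Rightarrow> real"
  assumes "f differentiable (at x)" "h differentiable (at x)"
  shows "partial \<nu> (\<lambda>y. f y * h y) x = f x * partial \<nu> h x + partial \<nu> f x * h x"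
  using assms unfolding frechet_derivative_works
  by (subst partial_has_derivative[OF has_derivative_mult]) (auto simp: partial_def)

lemma partial_sum:
  assumes "\<And>i. i \<in> I \<Longrightarrow> f i differentiable (at x)"
  shows "partial \<nu> (\<lambda>y. \<Sum>i\<in>I. f i y) x = (\<Sum>i\<in>I. partial \<nu> (f i) x)"
  using assms unfolding frechet_derivative_works
  by (subst partial_has_derivative[OF has_derivative_sum]) (auto simp: partial_def)

lemma partial_cong:
  assumes "open S" "x \<in> S" "\<And>y. y \<in> S \<Longrightarrow> f y = h y"
  shows "partial \<nu> f x = partial \<nu> h x"
proof -
  have "(f has_derivative D) (at x) \<longleftrightarrow> (h has_derivative D) (at x)" for D
    using has_derivative_transform_within_open[OF _ assms(1,2)] assms(3) by metis
  then show ?thesis unfolding partial_def frechet_derivative_def by simp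
qed

lemma differentiable_nth:
  fixes f :: "'a::real_normed_vector \<Rightarrow> 'b::real_normed_vector^'n"
  shows "f differentiable (at x) \<Longrightarrow> (\<lambda>y. f y $ i) differentiable (at x)"
  unfolding differentiable_def using bounded_linear.has_derivative[OF bounded_linear_vec_nth] by blast

lemma partial_nth:
  fixes f :: "real^4 \<Rightarrow> 'b::real_normed_vector^'n"
  assumes "f differentiable (at x)"
  shows "partial \<nu> (\<lambda>y. f y $ i) x = partial \<nu> f x $ i"
  using assms unfolding frechet_derivative_works
  by (subst partial_has_derivative[OF bounded_linear.has_derivative[OF bounded_linear_vec_nth]])
    (auto simp: partial_def)

text \<open>Stated within the half line because the density may reach 0. There the difference
  quotient is \<open>t powr (a - 1)\<close>, which tends to 0 as a > 1.\<close>

lemma has_field_derivative_powr_nonneg: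
  fixes r a :: real
  assumes "r \<ge> 0" "a > 1"
  shows "((\<lambda>t. t powr a) has_field_derivative a * r powr (a - 1)) (at r within {0..})"
proof (cases "r = 0")
  case False
  then have "((\<lambda>t. t powr a) has_field_derivative a * r powr (a - 1)) (at r)"
    using assms by (auto intro!: derivative_eq_intros)
  then show ?thesis by (rule has_field_derivative_at_within)
next
  case True
  have "continuous_on {0..} (\<lambda>t::real. t powr (a - 1))"
    using assms by (intro continuous_on_powr') auto
  then have "((\<lambda>t. t powr (a - 1)) \<longlongrightarrow> 0 powr (a - 1)) (at 0 within {0..})"
    unfolding continuous_on by (rule bspec) simp
  moreover have "\<forall>\<^sub>F t in at 0 within {0..}. t powr (a - 1) = (t powr a - 0 powr a) / (t - 0)"
    by (auto simp: eventually_at_filter powr_diff)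
  ultimately show ?thesis
    unfolding has_field_derivative_iff True by (simp add: tendsto_cong)
qed

section \<open>The Euler equations at a point of a fluid\<close>

text \<open>The equations are compared at a single point \<open>x\<close>; the open set \<Omega>
  around it is kept because the symmetry of g, the normalization of u and the identity for the
  inverse metric are differentiated there.\<close>

locale fluid =
  fixes K \<gamma> :: real and \<Omega> g \<epsilon> u x
  assumes K: "K > 0" and \<gamma>: "\<gamma> > 1" and fluid: "fluid_on K \<gamma> \<Omega> g \<epsilon> u" and x: "x \<in> \<Omega>"
begin

abbreviation "H \<equiv> matrix_inv (g x)"
abbreviation "l \<equiv> lower (g x) (u x)"
abbreviation "dg \<equiv> metric_deriv g x"
abbreviation "grad f \<equiv> \<chi> \<nu>. partial \<nu> f x"
abbreviation "\<rho> \<equiv> \<epsilon> x + pressure K \<gamma> (\<epsilon> x)"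
text \<open>The expansion of the flow. Together with the acceleration \<open>acc\<close> it is all
  that the equations retain of the covariant derivative of u.\<close>

abbreviation "\<theta> \<equiv> \<Sum>\<nu>\<in>UNIV. cov_vec g u x \<nu> \<nu>"
abbreviation "acc \<equiv> \<chi> \<beta>. \<Sum>\<nu>\<in>UNIV. u x $ \<nu> * cov_vec g u x \<nu> \<beta>"

lemma open_dom: "open \<Omega>"
  and adm: "y \<in> \<Omega> \<Longrightarrow> admissible K \<gamma> (g y) (\<epsilon> y) (u y)"
  using fluid by (auto simp: fluid_on_def)

lemma diff: "g differentiable (at x)" "u differentiable (at x)" "\<epsilon> differentiable (at x)"
    "(\<lambda>y. makino \<gamma> (\<epsilon> y)) differentiable (at x)"
  using fluid x by (auto simp: fluid_on_def)

lemma lor: "y \<in> \<Omega> \<Longrightarrow> lorentzian (g y)"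
  using adm by (auto simp: admissible_def)

lemma inv: "y \<in> \<Omega> \<Longrightarrow> invertible (g y)"
  using lor lorentzian_invertible by blast

lemma dens: "y \<in> \<Omega> \<Longrightarrow> \<epsilon> y \<ge> 0"
  using adm by (auto simp: admissible_def)

lemma norm: "y \<in> \<Omega> \<Longrightarrow> u y \<bullet> (g y *v u y) = -1"
  using adm by (auto simp: admissible_def inner_matrix_vector_mult)

section \<open>Covariant derivatives of the inverse metric and of the normalization\<close>

lemma transpose_H: "transpose H = H"
proof -
  have "transpose H ** g x = mat 1"
    using matrix_mul_matrix_inv(1)[OF inv[OF x]] lorentzian_transpose[OF lor[OF x]]
    by (metis matrix_transpose_mul transpose_mat)
  then have "(transpose H ** g x) ** H = H" by simp
  then show ?thesis
    using matrix_mul_matrix_inv(1)[OF inv[OF x]] by (simp flip: matrix_mul_assoc)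
qed

lemma H_sym: "H $ \<alpha> $ \<beta> = H $ \<beta> $ \<alpha>"
  using arg_cong[OF transpose_H, of "\<lambda>m. m $ \<beta> $ \<alpha>"] by (simp add: transpose_def)

lemma H_l: "H *v l = u x"
  using matrix_mul_matrix_inv(2)[OF inv[OF x]] by (simp add: lower_def matrix_vector_mul_assoc)

lemma inner_H_l: "l \<bullet> (H *v v) = u x \<bullet> v"
  using inner_matrix_commute[OF transpose_H, of l v] by (simp add: H_l inner_commute)

lemma dg_nth: "dg $ \<nu> $ \<alpha> $ \<beta> = partial \<nu> (\<lambda>y. g y $ \<alpha> $ \<beta>) x"
  by (simp add: metric_deriv_def partial_nth[OF differentiable_nth[OF diff(1)]] partial_nth[OF diff(1)])

lemma dg_sym: "dg $ \<nu> $ \<alpha> $ \<beta> = dg $ \<nu> $ \<beta> $ \<alpha>"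
  unfolding dg_nth using open_dom x lorentzian_sym[OF lor] by (rule partial_cong)

lemma diff_g: "(\<lambda>y. g y $ \<alpha> $ \<beta>) differentiable (at x)"
  by (intro differentiable_nth diff)

lemma diff_inv: "(\<lambda>y. matrix_inv (g y) $ \<alpha> $ \<beta>) differentiable (at x)"
proof -
  have "Cinf_on {A. invertible A} (\<lambda>A::real^4^4. matrix_inv A $ \<alpha> $ \<beta>)"
    by (intro Cinf_intros open_invertible Cinf_on_bounded_linear
        bounded_linear_compose[OF bounded_linear_vec_nth bounded_linear_vec_nth]) auto
  then have "(\<lambda>A. matrix_inv A $ \<alpha> $ \<beta>) differentiable (at (g x))"
    using inv[OF x] by (auto intro: Cinf_on_differentiable)
  from differentiable_chain_at[OF diff(1) this] show ?thesis by (simp add: o_def)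
qed

text \<open>Differentiating the identity H g = 1 gives dH g = - H dg, which is then multiplied by H
  from the right.\<close>

lemma partial_inv:
  "partial \<nu> (\<lambda>y. matrix_inv (g y) $ \<alpha> $ \<beta>) x =
    - (\<Sum>\<sigma>\<in>UNIV. \<Sum>\<mu>\<in>UNIV. H $ \<alpha> $ \<sigma> * dg $ \<nu> $ \<sigma> $ \<mu> * H $ \<mu> $ \<beta>)"
proof -
  define D where "D = (\<chi> \<alpha> \<beta>. partial \<nu> (\<lambda>y. matrix_inv (g y) $ \<alpha> $ \<beta>) x)"
  have "(H ** (dg $ \<nu>) + D ** g x) $ \<alpha> $ \<mu> = 0" for \<alpha> \<mu>
  proof -
    have "(H ** (dg $ \<nu>) + D ** g x) $ \<alpha> $ \<mu> =
        partial \<nu> (\<lambda>y. \<Sum>\<sigma>\<in>UNIV. matrix_inv (g y) $ \<alpha> $ \<sigma> * g y $ \<sigma> $ \<mu>) x"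
      by (simp add: partial_sum partial_mult diff_g diff_inv D_def matrix_matrix_mult_def dg_nth
          sum.distrib)
    also have "\<dots> = partial \<nu> (\<lambda>y. (mat 1 :: real^4^4) $ \<alpha> $ \<mu>) x"
    proof (rule partial_cong[OF open_dom x])
      fix y assume y: "y \<in> \<Omega>"
      show "(\<Sum>\<sigma>\<in>UNIV. matrix_inv (g y) $ \<alpha> $ \<sigma> * g y $ \<sigma> $ \<mu>) = (mat 1 :: real^4^4) $ \<alpha> $ \<mu>"
        unfolding matrix_mul_matrix_inv(2)[OF inv[OF y], symmetric] by (simp add: matrix_matrix_mult_def)
    qed
    finally show ?thesis by simp
  qed
  then have "D ** g x = - (H ** (dg $ \<nu>))"
    by (simp add: vec_eq_iff eq_neg_iff_add_eq_0 add.commute)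
  then have "(D ** g x) ** H = - (H ** (dg $ \<nu>)) ** H" by simp
  then have "D = - (H ** (dg $ \<nu>)) ** H"
    using matrix_mul_matrix_inv(1)[OF inv[OF x]] by (simp flip: matrix_mul_assoc)
  then have "D $ \<alpha> $ \<beta> = (- (H ** (dg $ \<nu>)) ** H) $ \<alpha> $ \<beta>" by simp
  also have "\<dots> = - (\<Sum>\<mu>\<in>UNIV. \<Sum>\<sigma>\<in>UNIV. H $ \<alpha> $ \<sigma> * dg $ \<nu> $ \<sigma> $ \<mu> * H $ \<mu> $ \<beta>)"
    by (simp add: matrix_matrix_mult_def sum_distrib_right sum_negf)
  finally show ?thesis unfolding D_def by (subst sum.swap) simp
qed

text \<open>The two Christoffel sums contain the bracket \<open>T\<close> with its indices
  interchanged, so they see only its symmetrization 2 dg, and \<open>partial_inv\<close> cancels the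
  result. This is the covariant constancy of the inverse metric.\<close>

lemma metric_compatible:
  "partial \<nu> (\<lambda>y. matrix_inv (g y) $ \<alpha> $ \<beta>) x + (\<Sum>\<mu>\<in>UNIV. christoffel g x \<alpha> \<nu> \<mu> * H $ \<mu> $ \<beta>)
    + (\<Sum>\<mu>\<in>UNIV. christoffel g x \<beta> \<nu> \<mu> * H $ \<alpha> $ \<mu>) = 0"
proof -
  define T where "T \<sigma> \<mu> = dg $ \<nu> $ \<sigma> $ \<mu> + dg $ \<mu> $ \<sigma> $ \<nu> - dg $ \<sigma> $ \<nu> $ \<mu>" for \<sigma> \<mu>
  have chr: "christoffel g x \<alpha> \<nu> \<mu> = (1/2) * (\<Sum>\<sigma>\<in>UNIV. H $ \<alpha> $ \<sigma> * T \<sigma> \<mu>)" for \<alpha> \<mu>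
    by (simp add: christoffel_def T_def)
  have "(\<Sum>\<mu>\<in>UNIV. christoffel g x \<alpha> \<nu> \<mu> * H $ \<mu> $ \<beta>) =
      (\<Sum>\<mu>\<in>UNIV. \<Sum>\<sigma>\<in>UNIV. (1/2) * (H $ \<alpha> $ \<sigma> * T \<sigma> \<mu> * H $ \<mu> $ \<beta>))"
    by (simp add: chr sum_distrib_right sum_distrib_left mult.assoc)
  then have 1: "(\<Sum>\<mu>\<in>UNIV. christoffel g x \<alpha> \<nu> \<mu> * H $ \<mu> $ \<beta>) =
      (\<Sum>\<sigma>\<in>UNIV. \<Sum>\<mu>\<in>UNIV. (1/2) * (H $ \<alpha> $ \<sigma> * T \<sigma> \<mu> * H $ \<mu> $ \<beta>))"
    by (subst sum.swap) simp
  have 2: "(\<Sum>\<mu>\<in>UNIV. christoffel g x \<beta> \<nu> \<mu> * H $ \<alpha> $ \<mu>) =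
      (\<Sum>\<sigma>\<in>UNIV. \<Sum>\<mu>\<in>UNIV. (1/2) * (H $ \<alpha> $ \<sigma> * T \<mu> \<sigma> * H $ \<mu> $ \<beta>))"
    unfolding chr
    by (simp add: sum_distrib_right sum_distrib_left H_sym[of \<beta>] mult_ac)
  have T: "T \<sigma> \<mu> + T \<mu> \<sigma> = 2 * dg $ \<nu> $ \<sigma> $ \<mu>" for \<sigma> \<mu>
    unfolding T_def using dg_sym[of \<nu> \<sigma> \<mu>] dg_sym[of \<mu> \<sigma> \<nu>] dg_sym[of \<sigma> \<mu> \<nu>] by linarith
  have half: "(1/2) * (a * T \<sigma> \<mu> * b) + (1/2) * (a * T \<mu> \<sigma> * b) = a * dg $ \<nu> $ \<sigma> $ \<mu> * b" for a b \<sigma> \<mu>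
  proof -
    have "(1/2) * (a * T \<sigma> \<mu> * b) + (1/2) * (a * T \<mu> \<sigma> * b) = (1/2) * (a * (T \<sigma> \<mu> + T \<mu> \<sigma>) * b)"
      by (simp only: algebra_simps)
    then show ?thesis unfolding T by simp
  qed
  then show ?thesis
    unfolding 1 2 partial_inv add.assoc sum.distrib[symmetric] half by simp
qed

text \<open>Differentiating g(u,u) = -1 in coordinates leaves, besides the derivatives of u, a term
  in dg; the Christoffel part of the covariant derivative accounts for exactly that term.\<close>

lemma l_cov: "(\<Sum>\<beta>\<in>UNIV. l $ \<beta> * cov_vec g u x \<nu> \<beta>) = 0"
proof -
  let ?v = "u x" and ?d = "\<lambda>\<beta>. partial \<nu> (\<lambda>y. u y $ \<beta>) x"
  have du: "(\<lambda>y. u y $ \<beta>) differentiable (at x)" for \<beta>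
    by (intro differentiable_nth diff)
  have l: "l $ \<beta> = (\<Sum>\<alpha>\<in>UNIV. g x $ \<alpha> $ \<beta> * ?v $ \<alpha>)" for \<beta>
    using lorentzian_sym[OF lor[OF x]] by (simp add: lower_def matrix_vector_mult_def)
  \<comment> \<open>The normalization holds throughout \<Omega>, so its derivative at
    \<open>x\<close> vanishes.\<close>
  have "0 = partial \<nu> (\<lambda>y. -1 :: real) x" by simp
  also have "\<dots> = partial \<nu> (\<lambda>y. \<Sum>\<alpha>\<in>UNIV. \<Sum>\<beta>\<in>UNIV. g y $ \<alpha> $ \<beta> * u y $ \<alpha> * u y $ \<beta>) x"
    using norm unfolding inner_matrix_vector_mult by (intro partial_cong[OF open_dom x]) simp
  also have "\<dots> = (\<Sum>\<alpha>\<in>UNIV. \<Sum>\<beta>\<in>UNIV. g x $ \<alpha> $ \<beta> * ?v $ \<alpha> * ?d \<beta> +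
      (g x $ \<alpha> $ \<beta> * ?d \<alpha> + dg $ \<nu> $ \<alpha> $ \<beta> * ?v $ \<alpha>) * ?v $ \<beta>)"
    by (simp add: partial_sum partial_mult du diff_g dg_nth)
  also have "\<dots> = (\<Sum>\<alpha>\<in>UNIV. \<Sum>\<beta>\<in>UNIV. g x $ \<alpha> $ \<beta> * ?v $ \<alpha> * ?d \<beta>)
      + (\<Sum>\<alpha>\<in>UNIV. \<Sum>\<beta>\<in>UNIV. g x $ \<alpha> $ \<beta> * ?d \<alpha> * ?v $ \<beta>)
      + (\<Sum>\<alpha>\<in>UNIV. \<Sum>\<beta>\<in>UNIV. dg $ \<nu> $ \<alpha> $ \<beta> * ?v $ \<alpha> * ?v $ \<beta>)"
    by (simp add: sum.distrib distrib_right add.assoc)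
  also have "(\<Sum>\<alpha>\<in>UNIV. \<Sum>\<beta>\<in>UNIV. g x $ \<alpha> $ \<beta> * ?v $ \<alpha> * ?d \<beta>) = (\<Sum>\<beta>\<in>UNIV. l $ \<beta> * ?d \<beta>)"
    by (subst sum.swap) (simp add: l sum_distrib_right)
  also have "(\<Sum>\<alpha>\<in>UNIV. \<Sum>\<beta>\<in>UNIV. g x $ \<alpha> $ \<beta> * ?d \<alpha> * ?v $ \<beta>) = (\<Sum>\<beta>\<in>UNIV. l $ \<beta> * ?d \<beta>)"
    unfolding lower_def matrix_vector_mult_def vec_lambda_beta sum_distrib_right by (simp add: mult_ac)
  finally have n: "2 * (\<Sum>\<beta>\<in>UNIV. l $ \<beta> * ?d \<beta>)
      + (\<Sum>\<alpha>\<in>UNIV. \<Sum>\<beta>\<in>UNIV. dg $ \<nu> $ \<alpha> $ \<beta> * ?v $ \<alpha> * ?v $ \<beta>) = 0" by simp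
  have lH: "(\<Sum>\<beta>\<in>UNIV. l $ \<beta> * H $ \<beta> $ \<sigma>) = ?v $ \<sigma>" for \<sigma>
  proof -
    have "(H *v l) $ \<sigma> = ?v $ \<sigma>" by (simp add: H_l)
    then show ?thesis by (simp add: matrix_vector_mult_def H_sym[of \<sigma>] mult.commute)
  qed
  define T where "T \<sigma> \<mu> = dg $ \<nu> $ \<sigma> $ \<mu> + dg $ \<mu> $ \<sigma> $ \<nu> - dg $ \<sigma> $ \<nu> $ \<mu>" for \<sigma> \<mu>
  have lchr: "(\<Sum>\<beta>\<in>UNIV. l $ \<beta> * christoffel g x \<beta> \<nu> \<mu>) = (1/2) * (\<Sum>\<sigma>\<in>UNIV. ?v $ \<sigma> * T \<sigma> \<mu>)" for \<mu>
  proof -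
    have "(\<Sum>\<beta>\<in>UNIV. l $ \<beta> * christoffel g x \<beta> \<nu> \<mu>) =
        (1/2) * (\<Sum>\<beta>\<in>UNIV. \<Sum>\<sigma>\<in>UNIV. l $ \<beta> * H $ \<beta> $ \<sigma> * T \<sigma> \<mu>)"
      by (simp add: christoffel_def T_def sum_distrib_left mult_ac)
    also have "(\<Sum>\<beta>\<in>UNIV. \<Sum>\<sigma>\<in>UNIV. l $ \<beta> * H $ \<beta> $ \<sigma> * T \<sigma> \<mu>) = (\<Sum>\<sigma>\<in>UNIV. ?v $ \<sigma> * T \<sigma> \<mu>)"
      by (subst sum.swap) (simp add: lH flip: sum_distrib_right)
    finally show ?thesis .
  qed
  have "(\<Sum>\<beta>\<in>UNIV. l $ \<beta> * (\<Sum>\<mu>\<in>UNIV. christoffel g x \<beta> \<nu> \<mu> * ?v $ \<mu>)) =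
      (\<Sum>\<mu>\<in>UNIV. (\<Sum>\<beta>\<in>UNIV. l $ \<beta> * christoffel g x \<beta> \<nu> \<mu>) * ?v $ \<mu>)"
    unfolding sum_distrib_left sum_distrib_right by (subst sum.swap) (simp add: mult.assoc)
  also have "\<dots> = (1/2) * (\<Sum>\<mu>\<in>UNIV. \<Sum>\<sigma>\<in>UNIV. ?v $ \<sigma> * T \<sigma> \<mu> * ?v $ \<mu>)"
    unfolding lchr by (simp add: sum_distrib_left sum_distrib_right mult_ac)
  also have "(\<Sum>\<mu>\<in>UNIV. \<Sum>\<sigma>\<in>UNIV. ?v $ \<sigma> * T \<sigma> \<mu> * ?v $ \<mu>) =
      (\<Sum>\<mu>\<in>UNIV. \<Sum>\<sigma>\<in>UNIV. dg $ \<nu> $ \<mu> $ \<sigma> * ?v $ \<mu> * ?v $ \<sigma>)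
      + ((\<Sum>\<mu>\<in>UNIV. \<Sum>\<sigma>\<in>UNIV. dg $ \<mu> $ \<nu> $ \<sigma> * ?v $ \<sigma> * ?v $ \<mu>)
        - (\<Sum>\<mu>\<in>UNIV. \<Sum>\<sigma>\<in>UNIV. dg $ \<sigma> $ \<nu> $ \<mu> * ?v $ \<sigma> * ?v $ \<mu>))"
    unfolding T_def dg_sym[of _ _ \<nu>]
    by (simp add: dg_sym[of \<nu>] algebra_simps sum.distrib sum_subtractf)
  \<comment> \<open>The two sums differ only in the names of bound indices; in the symmetric
    contraction with u just the \<nu>-derivative of the metric remains.\<close>
  also have "(\<Sum>\<mu>\<in>UNIV. \<Sum>\<sigma>\<in>UNIV. dg $ \<mu> $ \<nu> $ \<sigma> * ?v $ \<sigma> * ?v $ \<mu>) =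
      (\<Sum>\<mu>\<in>UNIV. \<Sum>\<sigma>\<in>UNIV. dg $ \<sigma> $ \<nu> $ \<mu> * ?v $ \<sigma> * ?v $ \<mu>)"
    by (subst sum.swap) (simp add: mult_ac)
  finally have "2 * (\<Sum>\<beta>\<in>UNIV. l $ \<beta> * (\<Sum>\<mu>\<in>UNIV. christoffel g x \<beta> \<nu> \<mu> * ?v $ \<mu>)) =
      (\<Sum>\<mu>\<in>UNIV. \<Sum>\<sigma>\<in>UNIV. dg $ \<nu> $ \<mu> $ \<sigma> * ?v $ \<mu> * ?v $ \<sigma>)" by simp
  with n show ?thesis by (simp add: cov_vec_def distrib_left sum.distrib)
qed

lemma l_u: "l \<bullet> u x = -1"
  using norm[OF x] by (simp add: lower_def inner_commute)

lemma l_acc: "l \<bullet> acc = 0"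
proof -
  have "l \<bullet> acc = (\<Sum>\<nu>\<in>UNIV. u x $ \<nu> * (\<Sum>\<beta>\<in>UNIV. l $ \<beta> * cov_vec g u x \<nu> \<beta>))"
    unfolding inner_vec_def sum_distrib_left
    by (subst sum.swap) (simp add: sum_distrib_left mult_ac)
  then show ?thesis by (simp add: l_cov)
qed

text \<open>The derivative of \<open>f\<close> is given only within the half line, so the chain rule
  is applied within \<Omega>, which \<epsilon> maps into the half line; as \<Omega> is open, this is
  the full derivative.\<close>

lemma partial_eos:
  fixes f :: "real \<Rightarrow> real"
  assumes "(f has_field_derivative D) (at (\<epsilon> x) within {0..})"
  shows "(\<lambda>y. f (\<epsilon> y)) differentiable (at x)" "partial \<nu> (\<lambda>y. f (\<epsilon> y)) x = D * partial \<nu> \<epsilon> x"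
proof -
  have "(\<epsilon> has_derivative frechet_derivative \<epsilon> (at x)) (at x within \<Omega>)"
    using diff(3) unfolding frechet_derivative_works by (rule has_derivative_at_withinI)
  moreover have "(f has_derivative (*) D) (at (\<epsilon> x) within \<epsilon> ` \<Omega>)"
    using has_derivative_subset[of f "(*) D" "\<epsilon> x" "{0..}" "\<epsilon> ` \<Omega>"] assms dens
    by (auto simp: has_field_derivative_def)
  ultimately have "((f \<circ> \<epsilon>) has_derivative ((*) D \<circ> frechet_derivative \<epsilon> (at x))) (at x within \<Omega>)"
    by (rule diff_chain_within)
  then have "((\<lambda>y. f (\<epsilon> y)) has_derivative (\<lambda>h. D * frechet_derivative \<epsilon> (at x) h)) (at x)"
    using at_within_open[OF x open_dom] by (simp add: o_def)
  then show "(\<lambda>y. f (\<epsilon> y)) differentiable (at x)" "partial \<nu> (\<lambda>y. f (\<epsilon> y)) x = D * partial \<nu> \<epsilon> x"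
    by (auto simp: differentiable_def partial_has_derivative) (simp add: partial_def)
qed

lemma pressure_deriv:
  "(pressure K \<gamma> has_field_derivative K * (\<gamma> * \<epsilon> x powr (\<gamma> - 1))) (at (\<epsilon> x) within {0..})"
  unfolding pressure_def
  using DERIV_cmult[OF has_field_derivative_powr_nonneg[OF dens[OF x] \<gamma>]] .

lemmas diff_pressure = partial_eos(1)[OF pressure_deriv]
lemmas partial_pressure = partial_eos(2)[OF pressure_deriv]

section \<open>The divergence of the energy-momentum tensor\<close>

abbreviation "P \<equiv> \<lambda>y. pressure K \<gamma> (\<epsilon> y)"

abbreviation "E \<equiv> \<chi> \<beta>. cov_div g (energy_momentum K \<gamma> g \<epsilon> u) x \<beta>"

text \<open>Sorted by u, the acceleration and the raised pressure gradient, so that contraction with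
  \<open>l\<close> and lowering the index separate the components.\<close>

lemma cov_div_energy_momentum:
  "E = (u x \<bullet> grad \<epsilon> + u x \<bullet> grad P + \<rho> * \<theta>) *\<^sub>R u x + \<rho> *\<^sub>R acc + H *v grad P"
proof (rule vec_eq_iff[THEN iffD2], rule allI)
  fix \<beta>
  let ?v = "u x" and ?C = "christoffel g x"
  have du: "(\<lambda>y. u y $ \<beta>) differentiable (at x)" for \<beta>
    by (intro differentiable_nth diff)
  have "partial \<alpha> (\<lambda>y. energy_momentum K \<gamma> g \<epsilon> u y $ \<alpha> $ \<beta>) x
        + (\<Sum>\<mu>\<in>UNIV. ?C \<alpha> \<alpha> \<mu> * energy_momentum K \<gamma> g \<epsilon> u x $ \<mu> $ \<beta>)
        + (\<Sum>\<mu>\<in>UNIV. ?C \<beta> \<alpha> \<mu> * energy_momentum K \<gamma> g \<epsilon> u x $ \<alpha> $ \<mu>) =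
      (?v $ \<alpha> * partial \<alpha> \<epsilon> x + ?v $ \<alpha> * partial \<alpha> P x + \<rho> * cov_vec g u x \<alpha> \<alpha>) * ?v $ \<beta>
        + \<rho> * (?v $ \<alpha> * cov_vec g u x \<alpha> \<beta>) + H $ \<beta> $ \<alpha> * partial \<alpha> P x" for \<alpha>
  proof -
    let ?dH = "partial \<alpha> (\<lambda>y. matrix_inv (g y) $ \<alpha> $ \<beta>) x"
    have "partial \<alpha> (\<lambda>y. energy_momentum K \<gamma> g \<epsilon> u y $ \<alpha> $ \<beta>) x =
       (partial \<alpha> \<epsilon> x + partial \<alpha> P x) * ?v $ \<alpha> * ?v $ \<beta>
        + \<rho> * partial \<alpha> (\<lambda>y. u y $ \<alpha>) x * ?v $ \<beta> + \<rho> * ?v $ \<alpha> * partial \<alpha> (\<lambda>y. u y $ \<beta>) x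
        + partial \<alpha> P x * H $ \<alpha> $ \<beta> + P x * ?dH"
      unfolding energy_momentum_def vec_lambda_beta
      by (simp add: partial_add partial_mult diff diff_pressure diff_inv du algebra_simps)
    moreover have "(\<Sum>\<mu>\<in>UNIV. ?C \<alpha> \<alpha> \<mu> * energy_momentum K \<gamma> g \<epsilon> u x $ \<mu> $ \<beta>) =
       \<rho> * (\<Sum>\<mu>\<in>UNIV. ?C \<alpha> \<alpha> \<mu> * ?v $ \<mu>) * ?v $ \<beta> + P x * (\<Sum>\<mu>\<in>UNIV. ?C \<alpha> \<alpha> \<mu> * H $ \<mu> $ \<beta>)"
      unfolding energy_momentum_def vec_lambda_beta sum_distrib_left sum_distrib_right sum.distrib[symmetric]
      by (simp add: algebra_simps)
    moreover have "(\<Sum>\<mu>\<in>UNIV. ?C \<beta> \<alpha> \<mu> * energy_momentum K \<gamma> g \<epsilon> u x $ \<alpha> $ \<mu>) =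
       \<rho> * ?v $ \<alpha> * (\<Sum>\<mu>\<in>UNIV. ?C \<beta> \<alpha> \<mu> * ?v $ \<mu>) + P x * (\<Sum>\<mu>\<in>UNIV. ?C \<beta> \<alpha> \<mu> * H $ \<alpha> $ \<mu>)"
      unfolding energy_momentum_def vec_lambda_beta sum_distrib_left sum_distrib_right sum.distrib[symmetric]
      by (simp add: algebra_simps)
    \<comment> \<open>Outside \<rho>, undifferentiated p multiplies just the covariant derivative of
      the inverse metric.\<close>
    moreover have "P x * (?dH + (\<Sum>\<mu>\<in>UNIV. ?C \<alpha> \<alpha> \<mu> * H $ \<mu> $ \<beta>) + (\<Sum>\<mu>\<in>UNIV. ?C \<beta> \<alpha> \<mu> * H $ \<alpha> $ \<mu>)) = 0"
      unfolding metric_compatible by simp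
    ultimately show ?thesis
      unfolding cov_vec_def H_sym[of \<beta> \<alpha>] by (simp only: algebra_simps)
  qed
  then have "E $ \<beta> = (\<Sum>\<alpha>\<in>UNIV. (?v $ \<alpha> * partial \<alpha> \<epsilon> x + ?v $ \<alpha> * partial \<alpha> P x + \<rho> * cov_vec g u x \<alpha> \<alpha>) * ?v $ \<beta>
        + \<rho> * (?v $ \<alpha> * cov_vec g u x \<alpha> \<beta>) + H $ \<beta> $ \<alpha> * partial \<alpha> P x)"
    by (simp add: cov_div_def)
  also have "\<dots> = ((u x \<bullet> grad \<epsilon> + u x \<bullet> grad P + \<rho> * \<theta>) *\<^sub>R u x + \<rho> *\<^sub>R acc + H *v grad P) $ \<beta>"
    by (simp only: sum.distrib sum_distrib_left[symmetric] sum_distrib_right[symmetric] inner_vec_def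
        matrix_vector_mult_def vec_lambda_beta vector_add_component vector_scaleR_component
        inner_real_def real_scaleR_def)
  finally show "E $ \<beta> = \<dots>" .
qed

section \<open>Contractions with the projector and normal forms of the two systems\<close>

lemma sum_P_mix: "(\<Sum>\<nu>\<in>UNIV. P_mix (g x) (u x) \<nu> \<alpha> * f \<nu>) = f \<alpha> + l $ \<alpha> * (u x \<bullet> (\<chi> \<nu>. f \<nu>))"
  by (simp add: P_mix_def distrib_right sum.distrib inner_vec_def sum_distrib_left
      mult.assoc mult.left_commute if_distrib[of "\<lambda>t. t * _"] cong: if_cong)

lemma sum_acc: "(\<Sum>\<beta>\<in>UNIV. \<Sum>\<nu>\<in>UNIV. F \<beta> * u x $ \<nu> * cov_vec g u x \<nu> \<beta>) = (\<Sum>\<beta>\<in>UNIV. F \<beta> * acc $ \<beta>)"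
  by (simp add: sum_distrib_left mult_ac)

lemma P_low_acc: "(\<Sum>\<beta>\<in>UNIV. P_low (g x) (u x) \<alpha> \<beta> * acc $ \<beta>) = (g x *v acc) $ \<alpha>"
proof -
  have "(\<Sum>\<beta>\<in>UNIV. P_low (g x) (u x) \<alpha> \<beta> * a $ \<beta>) = (g x *v a) $ \<alpha> + l $ \<alpha> * (l \<bullet> a)" for a
    unfolding P_low_def inner_vec_def matrix_vector_mult_def sum_distrib_left vec_lambda_beta
      sum.distrib[symmetric] by (simp only: inner_real_def algebra_simps)
  then show ?thesis by (simp only: l_acc mult_zero_right add_0_right)
qed

text \<open>The rank one term sees only \<open>l_acc\<close>; exchanging \<open>P_low\<close> for
  \<open>Gam\<close> therefore leaves the equation unchanged.\<close>

lemma Gam_acc: "(\<Sum>\<beta>\<in>UNIV. Gam (g x) (u x) \<alpha> \<beta> * acc $ \<beta>) = (g x *v acc) $ \<alpha>"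
proof -
  have "(\<Sum>\<beta>\<in>UNIV. Gam (g x) (u x) \<alpha> \<beta> * a $ \<beta>) = (g x *v a) $ \<alpha> + 2 * l $ \<alpha> * (l \<bullet> a)" for a
    unfolding Gam_def inner_vec_def matrix_vector_mult_def sum_distrib_left vec_lambda_beta
      sum.distrib[symmetric] by (simp only: inner_real_def algebra_simps)
  then show ?thesis by (simp only: l_acc mult_zero_right add_0_right)
qed

text \<open>By \<open>l_cov\<close> the velocity part of the projector contributes nothing.\<close>

lemma P_mix_trace: "(\<Sum>\<nu>\<in>UNIV. \<Sum>\<beta>\<in>UNIV. P_mix (g x) (u x) \<nu> \<beta> * cov_vec g u x \<nu> \<beta>) = \<theta>"
proof -
  have "(\<Sum>\<beta>\<in>UNIV. P_mix (g x) (u x) \<nu> \<beta> * cov_vec g u x \<nu> \<beta>) =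
      cov_vec g u x \<nu> \<nu> + u x $ \<nu> * (\<Sum>\<beta>\<in>UNIV. l $ \<beta> * cov_vec g u x \<nu> \<beta>)" for \<nu>
    by (simp add: P_mix_def distrib_right sum.distrib sum_distrib_left mult.assoc
      if_distrib[of "\<lambda>t. t * _"] cong: if_cong)
  then show ?thesis by (simp add: l_cov)
qed

lemma decomposed_iff:
  "decomposed_euler_eq K \<gamma> g \<epsilon> u x \<longleftrightarrow> u x \<bullet> grad \<epsilon> + \<rho> * \<theta> = 0 \<and>
    (\<forall>\<alpha>. \<rho> * (g x *v acc) $ \<alpha> + (partial \<alpha> P x + l $ \<alpha> * (u x \<bullet> grad P)) = 0)"
  unfolding decomposed_euler_eq_def sum_acc P_low_acc sum_P_mix by (simp add: inner_vec_def)

text \<open>Written in the same quantities as \<open>decomposed_iff\<close>, so that the systems can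
  be compared row by row.\<close>

lemma makino_iff:
  "makino_eq K \<gamma> g w u x \<longleftrightarrow>
    (kappa K \<gamma> (w x))\<^sup>2 * (u x \<bullet> grad w) + kappa K \<gamma> (w x) * sound_speed K \<gamma> (w x) * \<theta> = 0 \<and>
    (\<forall>\<alpha>. kappa K \<gamma> (w x) * sound_speed K \<gamma> (w x) * (partial \<alpha> w x + l $ \<alpha> * (u x \<bullet> grad w))
       + (g x *v acc) $ \<alpha> = 0)"
  unfolding makino_eq_def sum_acc Gam_acc sum_P_mix P_mix_trace by (simp add: inner_vec_def)

text \<open>The two components of the divergence \<open>E\<close> are $-u_\beta E^\beta$ and
  $(g_{\alpha\beta} + u_\alpha u_\beta) E^\beta$; they determine \<open>E\<close> since \<open>g\<close> is invertible.\<close>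

lemma euler_iff_decomposed: "euler_eq K \<gamma> g \<epsilon> u x \<longleftrightarrow> decomposed_euler_eq K \<gamma> g \<epsilon> u x"
proof -
  let ?D = "u x \<bullet> grad \<epsilon> + u x \<bullet> grad P + \<rho> * \<theta>"
  have lE: "u x \<bullet> grad \<epsilon> + \<rho> * \<theta> = - (l \<bullet> E)"
    unfolding cov_div_energy_momentum inner_add_right inner_scaleR_right l_u l_acc inner_H_l by simp
  have "g x *v E = ?D *\<^sub>R l + \<rho> *\<^sub>R (g x *v acc) + grad P"
    unfolding cov_div_energy_momentum using matrix_mul_matrix_inv(1)[OF inv[OF x]]
    by (simp add: matrix_vector_right_distrib matrix_vector_mult_scaleR matrix_vector_mul_assoc lower_def)
  then have gEn: "(g x *v E) $ \<alpha> = ?D * l $ \<alpha> + \<rho> * (g x *v acc) $ \<alpha> + partial \<alpha> P x" for \<alpha>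
    by simp
  have lE': "l \<bullet> E = - (u x \<bullet> grad \<epsilon> + \<rho> * \<theta>)"
    using lE by linarith
  have gE: "\<rho> * (g x *v acc) $ \<alpha> + (partial \<alpha> P x + l $ \<alpha> * (u x \<bullet> grad P))
      = (g x *v E) $ \<alpha> + l $ \<alpha> * (l \<bullet> E)" for \<alpha>
    unfolding gEn lE' by (simp add: algebra_simps)
  have "euler_eq K \<gamma> g \<epsilon> u x \<longleftrightarrow> E = 0" by (simp add: euler_eq_def vec_eq_iff)
  also have "\<dots> \<longleftrightarrow> l \<bullet> E = 0 \<and> g x *v E = 0"
    using matrix_mul_matrix_inv(2)[OF inv[OF x]]
    by (metis inner_zero_right matrix_vector_mul_assoc matrix_vector_mul_lid matrix_vector_mult_0_right)
  \<comment> \<open>Once l . E = 0, the projected component reduces to g E itself.\<close>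
  also have "\<dots> \<longleftrightarrow> decomposed_euler_eq K \<gamma> g \<epsilon> u x"
    unfolding decomposed_iff lE gE by (auto simp: vec_eq_iff)
  finally show ?thesis .
qed

abbreviation "w \<equiv> \<lambda>y. makino \<gamma> (\<epsilon> y)"

text \<open>Multiplied by \<rho>, the scalar row becomes kappa \<sigma> times the energy equation
  and the other rows become the momentum equations; these factors are positive for positive
  density.\<close>

lemma makino_iff_decomposed:
  assumes pos: "\<epsilon> x > 0"
  shows "makino_eq K \<gamma> g w u x \<longleftrightarrow> decomposed_euler_eq K \<gamma> g \<epsilon> u x"
proof -
  let ?k = "kappa K \<gamma> (w x)" and ?s = "sound_speed K \<gamma> (w x)"
  have wpos: "w x > 0" using pos by (simp add: makino_def)
  have k: "?k > 0" using kappa_pos[OF K \<gamma>] .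
  have s: "?s > 0" using wpos K \<gamma> by (simp add: sound_speed_def)
  have w2: "(w x)\<^sup>2 = \<epsilon> x powr (\<gamma> - 1)"
    by (simp add: makino_def power2_eq_square flip: powr_add)
  have rho: "\<rho> = \<epsilon> x * (1 + K * (w x)\<^sup>2)"
    using pos by (simp add: w2 pressure_def powr_diff algebra_simps)
  have rpos: "\<rho> > 0" unfolding rho using pos K by (intro mult_pos_pos add_pos_nonneg) auto
  have s2: "?s\<^sup>2 = K * (\<gamma> * \<epsilon> x powr (\<gamma> - 1))"
    using K \<gamma> by (simp add: sound_speed_def power_mult_distrib w2)
  have dP: "partial \<nu> P x = ?s\<^sup>2 * partial \<nu> \<epsilon> x" for \<nu>
    unfolding s2 by (rule partial_pressure)
  have "(makino \<gamma> has_field_derivative (\<gamma> - 1) / 2 * \<epsilon> x powr ((\<gamma> - 1) / 2 - 1)) (at (\<epsilon> x))"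
    unfolding makino_def using pos by (auto intro!: derivative_eq_intros)
  then have "(makino \<gamma> has_field_derivative (\<gamma> - 1) / 2 * (w x / \<epsilon> x)) (at (\<epsilon> x) within {0..})"
    using pos by (simp add: makino_def powr_diff has_field_derivative_at_within)
  note dw = partial_eos(2)[OF this]
  \<comment> \<open>The identity that determines kappa.\<close>
  have "?k * ((\<gamma> - 1) / 2 * (w x / \<epsilon> x)) = ?s / \<rho>"
  proof -
    \<comment> \<open>To be read with h = \<gamma> - 1, q = sqrt (K \<gamma>), c = 1 + K w^2, v = w
      and e = \<epsilon>.\<close>
    have "2 / h * (q / c) * (h / 2 * (v / e)) = q * v / (e * c)" if "h \<noteq> 0" for h q c v e :: real
      using that by (simp add: field_simps)
    then show ?thesis
      unfolding kappa_def sound_speed_def rho mult.commute[of \<gamma> K] using \<gamma> by simp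
  qed
  then have "\<rho> * (?k * ((\<gamma> - 1) / 2 * (w x / \<epsilon> x))) = ?s"
    using rpos by (simp only: times_divide_eq_right nonzero_mult_div_cancel_left less_imp_neq[symmetric] not_False_eq_True)
  then have kdw: "\<rho> * (?k * partial \<nu> w x) = ?s * partial \<nu> \<epsilon> x" for \<nu>
    unfolding dw by (metis mult.assoc)
  have gw: "\<rho> * (?k * (u x \<bullet> grad w)) = ?s * (u x \<bullet> grad \<epsilon>)"
    using kdw by (simp add: inner_vec_def sum_distrib_left mult.left_commute[of _ "u x $ _"])
  have gP: "u x \<bullet> grad P = ?s\<^sup>2 * (u x \<bullet> grad \<epsilon>)"
    by (simp add: inner_vec_def sum_distrib_left dP mult_ac)
  have zero_iff: "a = 0 \<longleftrightarrow> b = 0" if "r * a = c * b" "r > 0" "c > 0" for r a c b :: real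
    using that by (metis mult_eq_0_iff less_irrefl)
  have "\<rho> * (?k\<^sup>2 * (u x \<bullet> grad w) + ?k * ?s * \<theta>) = ?k * (\<rho> * (?k * (u x \<bullet> grad w)) + \<rho> * ?s * \<theta>)"
    by (simp add: algebra_simps power2_eq_square)
  also have "\<dots> = (?k * ?s) * (u x \<bullet> grad \<epsilon> + \<rho> * \<theta>)"
    unfolding gw by (simp add: algebra_simps)
  finally have 1: "?k\<^sup>2 * (u x \<bullet> grad w) + ?k * ?s * \<theta> = 0 \<longleftrightarrow> u x \<bullet> grad \<epsilon> + \<rho> * \<theta> = 0"
    by (rule zero_iff[OF _ rpos mult_pos_pos[OF k s]])
  have 2: "?k * ?s * (partial \<alpha> w x + l $ \<alpha> * (u x \<bullet> grad w)) + (g x *v acc) $ \<alpha> = 0 \<longleftrightarrow>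
     \<rho> * (g x *v acc) $ \<alpha> + (partial \<alpha> P x + l $ \<alpha> * (u x \<bullet> grad P)) = 0" for \<alpha>
  proof -
    have "\<rho> * (?k * ?s * (partial \<alpha> w x + l $ \<alpha> * (u x \<bullet> grad w)) + (g x *v acc) $ \<alpha>) =
      ?s * (\<rho> * (?k * partial \<alpha> w x)) + ?s * l $ \<alpha> * (\<rho> * (?k * (u x \<bullet> grad w))) + \<rho> * (g x *v acc) $ \<alpha>"
      by (simp only: algebra_simps)
    \<comment> \<open>One \<sigma> stands in the row and one comes from \<open>kdw\<close>; their
      product turns d\<epsilon> into dp.\<close>
    also have "\<dots> = 1 * (\<rho> * (g x *v acc) $ \<alpha> + (partial \<alpha> P x + l $ \<alpha> * (u x \<bullet> grad P)))"
      unfolding kdw gw gP unfolding dP by (simp only: algebra_simps power2_eq_square mult_1_left)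
    finally show ?thesis by (rule zero_iff[OF _ rpos zero_less_one])
  qed
  show ?thesis unfolding makino_iff decomposed_iff 1 2 ..
qed

text \<open>Where the density vanishes it has a minimum, so all terms of the Euler equations vanish.\<close>

lemma euler_vacuum:
  assumes "\<epsilon> x = 0"
  shows "euler_eq K \<gamma> g \<epsilon> u x"
proof -
  have "frechet_derivative \<epsilon> (at x) = (\<lambda>v. 0)"
    using diff(3) dens assms unfolding frechet_derivative_works
    by (intro differential_zero_maxmin[OF x open_dom]) auto
  then have "partial \<nu> \<epsilon> x = 0" for \<nu> by (simp add: partial_def)
  moreover from this have "partial \<nu> P x = 0" for \<nu> by (simp add: partial_pressure)
  ultimately show ?thesis
    unfolding euler_iff_decomposed decomposed_iff
    by (simp add: assms pressure_def inner_vec_def)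
qed

end

section \<open>The evolution system\<close>

text \<open>Depends on the values of g and its first derivatives at a point, so that the source
  becomes a function of the state rather than of the metric field.\<close>

definition christoffel_of :: "real^4^4 \<Rightarrow> real^4^4^4 \<Rightarrow> 4 \<Rightarrow> 4 \<Rightarrow> 4 \<Rightarrow> real" where
  "christoffel_of g dg \<alpha> \<beta> \<gamma> = (1/2) * (\<Sum>\<mu>\<in>UNIV. matrix_inv g $ \<alpha> $ \<mu> *
     (dg $ \<beta> $ \<mu> $ \<gamma> + dg $ \<gamma> $ \<mu> $ \<beta> - dg $ \<mu> $ \<beta> $ \<gamma>))"

lemma christoffel_eq: "christoffel g x = christoffel_of (g x) (metric_deriv g x)"
  by (simp add: fun_eq_iff christoffel_def christoffel_of_def)

text \<open>The Christoffel parts of the covariant derivatives, moved to the right-hand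
  side.\<close>

definition source :: "real \<Rightarrow> real \<Rightarrow> (real^(4 option)) \<times> (real^4^4) \<times> (real^4^4^4) \<Rightarrow> real^(4 option)"
  where "source K \<gamma> s = (let U = fst s; g = fst (snd s); dg = snd (snd s); w = U $ None; v = velocity U in
    \<chi> i. case i of
      None \<Rightarrow> - (kappa K \<gamma> w * sound_speed K \<gamma> w *
        (\<Sum>\<nu>\<in>UNIV. \<Sum>\<beta>\<in>UNIV. P_mix g v \<nu> \<beta> * (\<Sum>\<mu>\<in>UNIV. christoffel_of g dg \<beta> \<nu> \<mu> * v $ \<mu>)))
    | Some \<alpha> \<Rightarrow> - (\<Sum>\<beta>\<in>UNIV. \<Sum>\<nu>\<in>UNIV. Gam g v \<alpha> \<beta> * v $ \<nu> *
        (\<Sum>\<mu>\<in>UNIV. christoffel_of g dg \<beta> \<nu> \<mu> * v $ \<mu>)))"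

lemma source_nth [simp]:
  "source K \<gamma> (unknown w v, g, dg) $ None = - (kappa K \<gamma> w * sound_speed K \<gamma> w *
    (\<Sum>\<nu>\<in>UNIV. \<Sum>\<beta>\<in>UNIV. P_mix g v \<nu> \<beta> * (\<Sum>\<mu>\<in>UNIV. christoffel_of g dg \<beta> \<nu> \<mu> * v $ \<mu>)))"
  "source K \<gamma> (unknown w v, g, dg) $ Some \<alpha> = - (\<Sum>\<beta>\<in>UNIV. \<Sum>\<nu>\<in>UNIV. Gam g v \<alpha> \<beta> * v $ \<nu> *
    (\<Sum>\<mu>\<in>UNIV. christoffel_of g dg \<beta> \<nu> \<mu> * v $ \<mu>))"
  by (simp_all add: source_def)

text \<open>The sign accounts for the spatial derivatives standing on the right in the evolution
  form.\<close>

definition evolution_matrix :: "real \<Rightarrow> real \<Rightarrow> (real^(4 option)) \<times> (real^4^4) \<Rightarrow> 4 \<Rightarrow>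
    real^(4 option)^(4 option)"
  where "evolution_matrix K \<gamma> s \<alpha> = (if \<alpha> = 0 then principal_matrix K \<gamma> s 0 else - principal_matrix K \<gamma> s \<alpha>)"

section \<open>Smoothness of the coefficients\<close>

lemma Cinf_on_kappa:
  assumes "K > 0" "open S" "Cinf_on S f"
  shows "Cinf_on S (\<lambda>x. kappa K \<gamma> (f x))"
proof -
  \<comment> \<open>The denominator of kappa has no real zero, so kappa is smooth across w = 0
    too.\<close>
  have "1 + K * t\<^sup>2 > 0" for t :: real using assms(1) by (intro add_pos_nonneg) auto
  then show ?thesis
    unfolding kappa_def by (intro Cinf_intros assms) (metis less_irrefl)
qed

lemma Cinf_on_nth:
  fixes f :: "'a::real_normed_vector \<Rightarrow> real^'n"
  shows "open S \<Longrightarrow> bounded_linear f \<Longrightarrow> Cinf_on S (\<lambda>x. f x $ i)"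
  by (intro Cinf_on_bounded_linear bounded_linear_compose[OF bounded_linear_vec_nth])

lemma Cinf_on_lower:
  assumes "open S" "\<And>\<alpha> \<beta>. Cinf_on S (\<lambda>x. G x $ \<alpha> $ \<beta>)" "\<And>\<alpha>. Cinf_on S (\<lambda>x. V x $ \<alpha>)"
  shows "Cinf_on S (\<lambda>x. lower (G x) (V x) $ \<alpha>)"
  unfolding lower_def matrix_vector_mult_def vec_lambda_beta by (intro Cinf_intros assms)

lemma Cinf_on_P_mix:
  assumes "open S" "\<And>\<alpha> \<beta>. Cinf_on S (\<lambda>x. G x $ \<alpha> $ \<beta>)" "\<And>\<alpha>. Cinf_on S (\<lambda>x. V x $ \<alpha>)"
  shows "Cinf_on S (\<lambda>x. P_mix (G x) (V x) \<nu> \<alpha>)"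
  unfolding P_mix_def by (intro Cinf_intros Cinf_on_lower assms)

lemma Cinf_on_Gam:
  assumes "open S" "\<And>\<alpha> \<beta>. Cinf_on S (\<lambda>x. G x $ \<alpha> $ \<beta>)" "\<And>\<alpha>. Cinf_on S (\<lambda>x. V x $ \<alpha>)"
  shows "Cinf_on S (\<lambda>x. Gam (G x) (V x) \<alpha> \<beta>)"
  unfolding Gam_def by (intro Cinf_intros Cinf_on_lower assms)

lemma Cinf_on_sound_speed: "open S \<Longrightarrow> Cinf_on S f \<Longrightarrow> Cinf_on S (\<lambda>x. sound_speed K \<gamma> (f x))"
  unfolding sound_speed_def by (intro Cinf_intros)

text \<open>\<open>P_mix\<close> and \<open>Gam\<close> are polynomial in the velocity and the lower
  metric components, which gives smoothness on the whole space.\<close>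

lemma Cinf_on_principal:
  assumes K: "K > 0"
  shows "Cinf_on UNIV (\<lambda>s. principal_matrix K \<gamma> s \<nu>)"
proof -
  have U: "Cinf_on UNIV (\<lambda>s :: (real^(4 option)) \<times> (real^4^4). fst s $ i)" for i
    by (intro Cinf_on_nth open_UNIV bounded_linear_fst)
  have g: "Cinf_on UNIV (\<lambda>s :: (real^(4 option)) \<times> (real^4^4). snd s $ \<alpha> $ \<beta>)" for \<alpha> \<beta>
    by (intro Cinf_on_nth open_UNIV bounded_linear_compose[OF bounded_linear_vec_nth] bounded_linear_snd)
  have v: "Cinf_on UNIV (\<lambda>s :: (real^(4 option)) \<times> (real^4^4). velocity (fst s) $ \<alpha>)" for \<alpha>
    by (simp add: velocity_def U)
  note smooth = Cinf_intros open_UNIV Cinf_on_kappa[OF K] Cinf_on_sound_speed Cinf_on_P_mix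
    Cinf_on_Gam U g v
  show ?thesis
    unfolding principal_matrix_def Let_def
  proof (rule Cinf_on_vec_lambda[OF open_UNIV Cinf_on_vec_lambda[OF open_UNIV]])
    show "Cinf_on UNIV (\<lambda>s. case i of
        None \<Rightarrow> (case j of
          None \<Rightarrow> (kappa K \<gamma> (fst s $ None))\<^sup>2 * velocity (fst s) $ \<nu>
        | Some \<beta> \<Rightarrow> kappa K \<gamma> (fst s $ None) * sound_speed K \<gamma> (fst s $ None)
            * P_mix (snd s) (velocity (fst s)) \<nu> \<beta>)
      | Some \<alpha> \<Rightarrow> (case j of
          None \<Rightarrow> kappa K \<gamma> (fst s $ None) * sound_speed K \<gamma> (fst s $ None)
            * P_mix (snd s) (velocity (fst s)) \<nu> \<alpha>
        | Some \<beta> \<Rightarrow> Gam (snd s) (velocity (fst s)) \<alpha> \<beta> * velocity (fst s) $ \<nu>))" for i j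
      by (cases i; cases j; simp only: option.case; intro smooth)
  qed
qed

lemma Cinf_on_evolution_matrix: "K > 0 \<Longrightarrow> Cinf_on UNIV (\<lambda>s. evolution_matrix K \<gamma> s \<alpha>)"
  unfolding evolution_matrix_def
  by (cases "\<alpha> = 0"; simp; intro Cinf_on_uminus open_UNIV Cinf_on_principal)

text \<open>The inverse metric in the Christoffel symbols confines the domain to the open set of
  invertible g.\<close>

lemma Cinf_on_source:
  assumes K: "K > 0"
  shows "Cinf_on {(U, g, dg). invertible g} (source K \<gamma>)"
proof -
  let ?S = "{(U, g, dg). invertible g} :: ((real^(4 option)) \<times> (real^4^4) \<times> (real^4^4^4)) set"
  have "?S = (\<lambda>s. fst (snd s)) -` {g. invertible g}" by auto
  also have "open \<dots>"
    by (intro open_vimage open_invertible continuous_intros)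
  finally have S: "open ?S" .
  have bg: "bounded_linear (\<lambda>s :: (real^(4 option)) \<times> (real^4^4) \<times> (real^4^4^4). fst (snd s))"
    and bdg: "bounded_linear (\<lambda>s :: (real^(4 option)) \<times> (real^4^4) \<times> (real^4^4^4). snd (snd s))"
    by (intro bounded_linear_compose[OF bounded_linear_fst] bounded_linear_compose[OF bounded_linear_snd]
        bounded_linear_snd)+
  have U: "Cinf_on ?S (\<lambda>s. fst s $ i)" for i
    by (intro Cinf_on_nth S bounded_linear_fst)
  have g: "Cinf_on ?S (\<lambda>s. fst (snd s) $ \<alpha> $ \<beta>)" for \<alpha> \<beta>
    by (intro Cinf_on_nth S bounded_linear_compose[OF bounded_linear_vec_nth] bg)
  have dg: "Cinf_on ?S (\<lambda>s. snd (snd s) $ \<mu> $ \<alpha> $ \<beta>)" for \<mu> \<alpha> \<beta>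
    by (intro Cinf_on_nth S bounded_linear_compose[OF bounded_linear_vec_nth] bdg)
  have v: "Cinf_on ?S (\<lambda>s. velocity (fst s) $ \<alpha>)" for \<alpha>
    by (simp add: velocity_def U)
  have H: "Cinf_on ?S (\<lambda>s. matrix_inv (fst (snd s)) $ \<alpha> $ \<beta>)" for \<alpha> \<beta>
    by (intro Cinf_on_matrix_inv S g) auto
  have C: "Cinf_on ?S (\<lambda>s. christoffel_of (fst (snd s)) (snd (snd s)) \<alpha> \<beta> \<mu>)" for \<alpha> \<beta> \<mu>
    unfolding christoffel_of_def by (intro Cinf_intros S dg H)
  note smooth = Cinf_on_uminus Cinf_on_mult Cinf_on_sum S Cinf_on_kappa[OF K] Cinf_on_sound_speed
    Cinf_on_P_mix Cinf_on_Gam U g v C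
  show ?thesis
    unfolding source_def[abs_def] Let_def
  proof (rule Cinf_on_vec_lambda[OF S])
    show "Cinf_on ?S (\<lambda>s. case i of
      None \<Rightarrow> - (kappa K \<gamma> (fst s $ None) * sound_speed K \<gamma> (fst s $ None) *
        (\<Sum>\<nu>\<in>UNIV. \<Sum>\<beta>\<in>UNIV. P_mix (fst (snd s)) (velocity (fst s)) \<nu> \<beta> *
          (\<Sum>\<mu>\<in>UNIV. christoffel_of (fst (snd s)) (snd (snd s)) \<beta> \<nu> \<mu> * velocity (fst s) $ \<mu>)))
    | Some \<alpha> \<Rightarrow> - (\<Sum>\<beta>\<in>UNIV. \<Sum>\<nu>\<in>UNIV. Gam (fst (snd s)) (velocity (fst s)) \<alpha> \<beta> * velocity (fst s) $ \<nu> *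
        (\<Sum>\<mu>\<in>UNIV. christoffel_of (fst (snd s)) (snd (snd s)) \<beta> \<nu> \<mu> * velocity (fst s) $ \<mu>)))" for i
      by (cases i; simp only: option.case; intro smooth)
  qed
qed

section \<open>The evolution form of the Makino system\<close>

lemma evolution_eq_iff:
  "evolution_eq (evolution_matrix K \<gamma>) B g U x \<longleftrightarrow>
    (\<Sum>\<nu>\<in>UNIV. principal_matrix K \<gamma> (U x, g x) \<nu> *v partial \<nu> U x) = B (U x, g x, metric_deriv g x)"
proof -
  have neg: "(- M) *v v = - (M *v v)" for M :: "real^(4 option)^(4 option)" and v
    by (simp add: matrix_vector_mult_def vec_eq_iff sum_negf)
  have 0: "(0::4) \<notin> {1, 2, 3}" by simp
  have "(\<Sum>a\<in>{1, 2, 3}. evolution_matrix K \<gamma> (U x, g x) a *v partial a U x) =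
      (\<Sum>a\<in>{1, 2, 3}. - (principal_matrix K \<gamma> (U x, g x) a *v partial a U x))"
    using 0 by (intro sum.cong) (auto simp: evolution_matrix_def neg)
  moreover have "(\<Sum>\<nu>\<in>UNIV. principal_matrix K \<gamma> (U x, g x) \<nu> *v partial \<nu> U x) =
      principal_matrix K \<gamma> (U x, g x) 0 *v partial 0 U x +
      (\<Sum>a\<in>{1, 2, 3}. principal_matrix K \<gamma> (U x, g x) a *v partial a U x)"
    unfolding UNIV_4_zero using 0 by (intro sum.insert) auto
  ultimately show ?thesis
    unfolding evolution_eq_def
    by (simp only: sum_negf evolution_matrix_def if_True simp_thms) (auto simp: algebra_simps)
qed

lemma partial_unknown:
  assumes w: "w differentiable (at x)" and u: "u differentiable (at x)"
  shows "partial \<nu> (\<lambda>y. unknown (w y) (u y)) x = unknown (partial \<nu> w x) (partial \<nu> u x)"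
proof -
  have "((\<lambda>y. unknown (w y) (u y)) has_derivative
      (\<lambda>h. unknown (frechet_derivative w (at x) h) (frechet_derivative u (at x) h))) (at x)"
  proof (subst has_derivative_componentwise_within, rule ballI)
    fix b :: "real^(4 option)"
    assume "b \<in> Basis"
    then obtain i where b: "b = axis i 1" by (auto simp: Basis_vec_def)
    have "((\<lambda>y. unknown (w y) (u y) $ i) has_derivative
      (\<lambda>h. unknown (frechet_derivative w (at x) h) (frechet_derivative u (at x) h) $ i)) (at x)"
      using w u unfolding frechet_derivative_works
      by (cases i) (auto intro: bounded_linear.has_derivative[OF bounded_linear_vec_nth])
    then show "((\<lambda>y. unknown (w y) (u y) \<bullet> b) has_derivative
      (\<lambda>h. unknown (frechet_derivative w (at x) h) (frechet_derivative u (at x) h) \<bullet> b)) (at x)"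
      by (simp add: b inner_axis)
  qed
  from partial_has_derivative[OF this] show ?thesis by (simp add: partial_def)
qed

text \<open>Each \<open>cov_vec\<close> splits into a partial derivative, which belongs to the
  principal part, and a Christoffel term, which belongs to the source with opposite sign; row by
  row, the difference of the two sides is the Makino equation.\<close>

lemma makino_iff_evolution:
  assumes w: "w differentiable (at x)" and u: "u differentiable (at x)"
  shows "makino_eq K \<gamma> g w u x \<longleftrightarrow>
    evolution_eq (evolution_matrix K \<gamma>) (source K \<gamma>) g (\<lambda>y. unknown (w y) (u y)) x"
proof -
  let ?k = "kappa K \<gamma> (w x)" and ?s = "sound_speed K \<gamma> (w x)"
  let ?L = "\<Sum>\<nu>\<in>UNIV. principal_matrix K \<gamma> (unknown (w x) (u x), g x) \<nu> *v partial \<nu> (\<lambda>y. unknown (w y) (u y)) x"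
  let ?B = "source K \<gamma> (unknown (w x) (u x), g x, metric_deriv g x)"
  have du: "partial \<nu> u x $ \<beta> = partial \<nu> (\<lambda>y. u y $ \<beta>) x" for \<nu> \<beta>
    using partial_nth[OF u] by simp
  note expand = matrix_vector_mult_def sum_option partial_unknown[OF w u] du
  have "?L $ None - ?B $ None = ?k\<^sup>2 * (\<Sum>\<nu>\<in>UNIV. u x $ \<nu> * partial \<nu> w x)
       + ?k * ?s * (\<Sum>\<nu>\<in>UNIV. \<Sum>\<beta>\<in>UNIV. P_mix (g x) (u x) \<nu> \<beta> * cov_vec g u x \<nu> \<beta>)"
    by (simp add: expand cov_vec_def christoffel_eq distrib_left sum.distrib)
      (simp add: sum_distrib_left mult.assoc)
  moreover have "?L $ Some \<alpha> - ?B $ Some \<alpha> =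
      ?k * ?s * (\<Sum>\<nu>\<in>UNIV. P_mix (g x) (u x) \<nu> \<alpha> * partial \<nu> w x)
        + (\<Sum>\<beta>\<in>UNIV. \<Sum>\<nu>\<in>UNIV. Gam (g x) (u x) \<alpha> \<beta> * u x $ \<nu> * cov_vec g u x \<nu> \<beta>)" for \<alpha>
  proof -
    have "?L $ Some \<alpha> = ?k * ?s * (\<Sum>\<nu>\<in>UNIV. P_mix (g x) (u x) \<nu> \<alpha> * partial \<nu> w x)
        + (\<Sum>\<nu>\<in>UNIV. \<Sum>\<beta>\<in>UNIV. Gam (g x) (u x) \<alpha> \<beta> * u x $ \<nu> * partial \<nu> (\<lambda>y. u y $ \<beta>) x)"
      by (simp add: expand sum.distrib sum_distrib_left mult.assoc)
    also have "(\<Sum>\<nu>\<in>UNIV. \<Sum>\<beta>\<in>UNIV. Gam (g x) (u x) \<alpha> \<beta> * u x $ \<nu> * partial \<nu> (\<lambda>y. u y $ \<beta>) x) =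
        (\<Sum>\<beta>\<in>UNIV. \<Sum>\<nu>\<in>UNIV. Gam (g x) (u x) \<alpha> \<beta> * u x $ \<nu> * partial \<nu> (\<lambda>y. u y $ \<beta>) x)"
      by (rule sum.swap)
    finally show ?thesis
      by (simp add: cov_vec_def christoffel_eq distrib_left sum.distrib)
  qed
  moreover have "?L = ?B \<longleftrightarrow> ?L $ None - ?B $ None = 0 \<and> (\<forall>\<alpha>. ?L $ Some \<alpha> - ?B $ Some \<alpha> = 0)"
    unfolding vec_eq_iff[of ?L ?B] split_option_all right_minus_eq ..
  ultimately show ?thesis unfolding evolution_eq_iff makino_eq_def by simp
qed

lemma state_regionE:
  assumes "s \<in> state_region K \<gamma>"
  obtains \<epsilon> v g where "s = (unknown (makino \<gamma> \<epsilon>) v, g)" "admissible K \<gamma> g \<epsilon> v" "lorentzian (snd s)"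
  using assms by (auto simp: state_region_def admissible_def)

theorem theorem3p3:
  fixes K \<gamma> :: real
  assumes "K > 0" and "\<gamma> > 1"
  shows "\<exists>(A :: (real^(4 option)) \<times> (real^4^4) \<Rightarrow> 4 \<Rightarrow> real^(4 option)^(4 option))
          (B :: (real^(4 option)) \<times> (real^4^4) \<times> (real^4^4^4) \<Rightarrow> real^(4 option)).
      (\<forall>\<alpha>. Cinf_on UNIV (\<lambda>s. A s \<alpha>)) \<and>
      Cinf_on {(U, g, dg). invertible g} B \<and>
      symmetric_hyperbolic_on (state_region K \<gamma>) (\<lambda>s \<alpha>. if \<alpha> = 0 then A s 0 else - A s \<alpha>) \<and>
      (\<forall>s\<in>state_region K \<gamma>.
         (\<forall>\<alpha>. transpose (A s \<alpha>) = A s \<alpha>) \<and> positive_definite (A s 0)) \<and>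
      (\<forall>\<Omega> g \<epsilon> u. fluid_on K \<gamma> \<Omega> g \<epsilon> u \<longrightarrow>
         (\<forall>x\<in>\<Omega>.
            let w = (\<lambda>y. makino \<gamma> (\<epsilon> y)); U = (\<lambda>y. unknown (w y) (u y)) in
            (euler_eq K \<gamma> g \<epsilon> u x \<longleftrightarrow> decomposed_euler_eq K \<gamma> g \<epsilon> u x) \<and>
            (makino_eq K \<gamma> g w u x \<longleftrightarrow> evolution_eq A B g U x) \<and>
            (\<epsilon> x > 0 \<longrightarrow> (euler_eq K \<gamma> g \<epsilon> u x \<longleftrightarrow> evolution_eq A B g U x)) \<and>
            (evolution_eq A B g U x \<longrightarrow> euler_eq K \<gamma> g \<epsilon> u x)))"
proof (rule exI[of _ "evolution_matrix K \<gamma>"], rule exI[of _ "source K \<gamma>"], intro conjI allI ballI impI)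
  show "Cinf_on UNIV (\<lambda>s. evolution_matrix K \<gamma> s \<alpha>)" for \<alpha>
    using assms(1) by (rule Cinf_on_evolution_matrix)
  show "Cinf_on {(U, g, dg). invertible g} (source K \<gamma>)"
    using assms(1) by (rule Cinf_on_source)
  have pos: "positive_definite (principal_matrix K \<gamma> s 0)"
    and sym: "transpose (principal_matrix K \<gamma> s \<alpha>) = principal_matrix K \<gamma> s \<alpha>" if "s \<in> state_region K \<gamma>" for s \<alpha>
    using that positive_definite_principal[OF assms] transpose_principal
    by (metis state_regionE)+
  show "symmetric_hyperbolic_on (state_region K \<gamma>)
      (\<lambda>s \<alpha>. if \<alpha> = 0 then evolution_matrix K \<gamma> s 0 else - evolution_matrix K \<gamma> s \<alpha>)"
    unfolding symmetric_hyperbolic_on_def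
  proof (intro ballI conjI allI)
    fix s assume s: "s \<in> state_region K \<gamma>"
    have eq: "(if \<alpha> = 0 then evolution_matrix K \<gamma> s 0 else - evolution_matrix K \<gamma> s \<alpha>) = principal_matrix K \<gamma> s \<alpha>"
      for \<alpha> by (simp add: evolution_matrix_def)
    show "transpose (if \<alpha> = 0 then evolution_matrix K \<gamma> s 0 else - evolution_matrix K \<gamma> s \<alpha>) =
        (if \<alpha> = 0 then evolution_matrix K \<gamma> s 0 else - evolution_matrix K \<gamma> s \<alpha>)" for \<alpha>
      unfolding eq by (rule sym[OF s])
    \<comment> \<open>The covector dt is the witness \<xi>.\<close>
    have "(\<Sum>\<alpha>\<in>UNIV. (axis 0 1 :: real^4) $ \<alpha> *\<^sub>R principal_matrix K \<gamma> s \<alpha>) = principal_matrix K \<gamma> s 0"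
      by (simp add: axis_def if_distrib[of "\<lambda>t. t *\<^sub>R _"] cong: if_cong)
    then show "\<exists>\<xi>::real^4. positive_definite (\<Sum>\<alpha>\<in>UNIV. \<xi> $ \<alpha> *\<^sub>R
        (if \<alpha> = 0 then evolution_matrix K \<gamma> s 0 else - evolution_matrix K \<gamma> s \<alpha>))"
      unfolding eq using pos[OF s] by metis
  qed
  fix s assume s: "s \<in> state_region K \<gamma>"
  show "transpose (evolution_matrix K \<gamma> s \<alpha>) = evolution_matrix K \<gamma> s \<alpha>" for \<alpha>
  proof -
    have "transpose (- M) = - transpose M" for M :: "real^(4 option)^(4 option)"
      by (simp add: transpose_def vec_eq_iff)
    then show ?thesis using sym[OF s] by (simp add: evolution_matrix_def)
  qed
  show "positive_definite (evolution_matrix K \<gamma> s 0)"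
    using pos[OF s] by (simp add: evolution_matrix_def)
next
  fix \<Omega> g \<epsilon> u x
  assume "fluid_on K \<gamma> \<Omega> g \<epsilon> u" and "x \<in> \<Omega>"
  then interpret fluid K \<gamma> \<Omega> g \<epsilon> u x using assms by unfold_locales
  have evo: "makino_eq K \<gamma> g w u x \<longleftrightarrow>
      evolution_eq (evolution_matrix K \<gamma>) (source K \<gamma>) g (\<lambda>y. unknown (w y) (u y)) x"
    using diff by (intro makino_iff_evolution)
  \<comment> \<open>At a vacuum point the last implication holds because its conclusion does, by
    \<open>euler_vacuum\<close>.\<close>
  have "\<epsilon> x = 0 \<or> \<epsilon> x > 0" using dens[OF x] by auto
  then show "let w = (\<lambda>y. makino \<gamma> (\<epsilon> y)); U = (\<lambda>y. unknown (w y) (u y)) in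
      (euler_eq K \<gamma> g \<epsilon> u x \<longleftrightarrow> decomposed_euler_eq K \<gamma> g \<epsilon> u x) \<and>
      (makino_eq K \<gamma> g w u x \<longleftrightarrow> evolution_eq (evolution_matrix K \<gamma>) (source K \<gamma>) g U x) \<and>
      (\<epsilon> x > 0 \<longrightarrow> (euler_eq K \<gamma> g \<epsilon> u x \<longleftrightarrow>
        evolution_eq (evolution_matrix K \<gamma>) (source K \<gamma>) g U x)) \<and>
      (evolution_eq (evolution_matrix K \<gamma>) (source K \<gamma>) g U x \<longrightarrow> euler_eq K \<gamma> g \<epsilon> u x)"
    unfolding Let_def
    using evo makino_iff_decomposed euler_iff_decomposed euler_vacuum by blast
qed

end
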